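(* Let $r\ge 1$ be an integer, and let $H$ be a connected bipartite graph whose two bipartition classes both have size $a$, and which contains a matching of size $a$. Then, as $n\to\infty$, $$Rt_r(H;K_n)=\left(\frac{1}{a(r+1)}+o(1)\right)n .$$
   Context: Here $a\ge 1$ is an integer. For an edge-colouring $\chi:E(K_n)\to[r]$, let $\nu_H(\chi)$ be the maximum over colours $\ell\in[r]$ of the maximum number of vertex-disjoint copies of $H$ all of whose edges have colour $\ell$. Then $Rt_r(H;K_n):=\min_{\chi:E(K_n)\to[r]}\nu_H(\chi)$. *)

theory Defs
  imports Complex_Main "HOL-Library.FuncSet" "HOL-Library.Landau_Symbols"
begin

type_synonym 'v ugraph = "'v set \<times> 'v set set"

abbreviation vertices :: "'v ugraph \<Rightarrow> 'v set" where
  "vertices G \<equiv> fst G"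

abbreviation edges :: "'v ugraph \<Rightarrow> 'v set set" where
  "edges G \<equiv> snd G"

definition simple_graph :: "'v ugraph \<Rightarrow> bool" where
  "simple_graph G \<longleftrightarrow> finite (vertices G) \<and> (\<forall>e\<in>edges G. e \<subseteq> vertices G \<and> card e = 2)"

definition adj :: "'v ugraph \<Rightarrow> ('v \<times> 'v) set" where
  "adj G = {(u, v). {u, v} \<in> edges G}"

definition connected_graph :: "'v ugraph \<Rightarrow> bool" where
  "connected_graph G \<longleftrightarrow>
     vertices G \<noteq> {} \<and> (\<forall>u\<in>vertices G. \<forall>v\<in>vertices G. (u, v) \<in> (adj G)\<^sup>*)"

definition bipartition :: "'v ugraph \<Rightarrow> 'v set \<Rightarrow> 'v set \<Rightarrow> bool" where
  "bipartition G A B \<longleftrightarrow>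
     A \<union> B = vertices G \<and> A \<inter> B = {} \<and> (\<forall>e\<in>edges G. \<exists>x\<in>A. \<exists>y\<in>B. e = {x, y})"

definition matching :: "'v ugraph \<Rightarrow> 'v set set \<Rightarrow> bool" where
  "matching G M \<longleftrightarrow> M \<subseteq> edges G \<and> pairwise disjnt M"

definition complete_graph :: "nat \<Rightarrow> nat ugraph" where
  "complete_graph n = ({1..n}, {e. e \<subseteq> {1..n} \<and> card e = 2})"

text \<open>Copies are subgraphs isomorphic to \<open>H\<close>, not necessarily induced.\<close>

definition is_copy :: "'v ugraph \<Rightarrow> 'w ugraph \<Rightarrow> 'w ugraph \<Rightarrow> bool" where
  "is_copy H G C \<longleftrightarrow>
     vertices C \<subseteq> vertices G \<and> edges C \<subseteq> edges G \<and>
     (\<exists>f. inj_on f (vertices H) \<and> vertices C = f ` vertices H \<and>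
          edges C = (\<lambda>e. f ` e) ` edges H)"

definition disjoint_copies :: "'v ugraph \<Rightarrow> 'w ugraph \<Rightarrow> 'w ugraph set \<Rightarrow> bool" where
  "disjoint_copies H G P \<longleftrightarrow>
     (\<forall>C\<in>P. is_copy H G C) \<and> pairwise (\<lambda>C D. disjnt (vertices C) (vertices D)) P"

definition packing_number :: "'v ugraph \<Rightarrow> 'w ugraph \<Rightarrow> nat" where
  "packing_number H G = Max {card P | P. disjoint_copies H G P}"

text \<open>Colourings are extensional (\<open>undefined\<close> off the edges of \<open>K\<^sub>n\<close>),
  so that there are finitely many of them.\<close>

definition colourings :: "nat \<Rightarrow> nat \<Rightarrow> (nat set \<Rightarrow> nat) set" where
  "colourings r n = edges (complete_graph n) \<rightarrow>\<^sub>E {1..r}"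

definition colour_class :: "nat \<Rightarrow> (nat set \<Rightarrow> nat) \<Rightarrow> nat \<Rightarrow> nat ugraph" where
  "colour_class n \<chi> l = ({1..n}, {e \<in> edges (complete_graph n). \<chi> e = l})"

definition nu :: "nat \<Rightarrow> nat \<Rightarrow> 'v ugraph \<Rightarrow> (nat set \<Rightarrow> nat) \<Rightarrow> nat" where
  "nu r n H \<chi> = Max ((\<lambda>l. packing_number H (colour_class n \<chi> l)) ` {1..r})"

definition Rt :: "nat \<Rightarrow> 'v ugraph \<Rightarrow> nat \<Rightarrow> nat" where
  "Rt r H n = Min (nu r n H ` colourings r n)"

text \<open>The maxima and minima above range over finite nonempty sets.\<close>

lemma finite_packing_sizes:
  fixes H :: "'v ugraph" and G :: "'w ugraph"
  assumes "simple_graph G"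
  shows "finite {card P | P. disjoint_copies H G P}"
    and "{card P | P. disjoint_copies H G P} \<noteq> {}"
proof -
  have "edges G \<subseteq> Pow (vertices G)" and fin: "finite (vertices G)"
    using assms by (auto simp: simple_graph_def)
  hence fin2: "finite (Pow (vertices G) \<times> Pow (edges G))"
    by (meson finite_Pow_iff finite_SigmaI finite_subset)
  have "P \<subseteq> Pow (vertices G) \<times> Pow (edges G)" if "disjoint_copies H G P" for P
    using that by (fastforce simp: disjoint_copies_def is_copy_def)
  hence "{card P | P. disjoint_copies H G P} \<subseteq> card ` Pow (Pow (vertices G) \<times> Pow (edges G))"
    by blast
  thus "finite {card P | P. disjoint_copies H G P}"
    using fin2 by (meson finite_Pow_iff finite_imageI finite_subset)
  have "disjoint_copies H G {}" by (simp add: disjoint_copies_def)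
  thus "{card P | P. disjoint_copies H G P} \<noteq> {}" by blast
qed

lemma simple_graph_colour_class: "simple_graph (colour_class n \<chi> l)"
  by (auto simp: simple_graph_def colour_class_def complete_graph_def)

lemma finite_colourings: "finite (colourings r n)"
  unfolding colourings_def complete_graph_def by (intro finite_PiE) auto

lemma colourings_nonempty: "r \<ge> 1 \<Longrightarrow> colourings r n \<noteq> {}"
  unfolding colourings_def by (auto simp: PiE_eq_empty_iff)

end

theory Submission
  imports Defs "HOL-Library.Multiset" "HOL-Library.Disjoint_Sets"
begin

text \<open>
For the upper bound, cut the vertices into \<open>r - 1\<close> blocks of size about \<open>n / (r + 1)\<close> and a last one
of twice that size, and give an edge the smaller block index of its two ends.  In a colour
\<open>l < r\<close> every edge meets block \<open>l\<close>, so a copy of \<open>H\<close>, having a matching of size \<open>a\<close>, uses \<open>a\<close> vertices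
of that block; in colour \<open>r\<close> every copy has \<open>2 a\<close> vertices inside the last block.  Either
way there are at most about \<open>n / (a (r + 1))\<close> disjoint copies (\<open>Rt_le\<close>).

For the lower bound, \<open>H\<close> is a spanning subgraph of \<open>K\<^bsub>a,a\<^esub>\<close>, so it is enough to pack copies of
\<open>K\<^bsub>a,a\<^esub>\<close>.  The model is the fractional version for \<open>a = 1\<close>.  By duality and half-integrality, the
fractional matching number of the colour class \<open>l\<close> is half the total of some vertex weighting
\<open>Z\<^sub>l\<close> with values in \<open>{0, 1, 2}\<close> for which \<open>Z\<^sub>l u + Z\<^sub>l v \<ge> 2\<close> on every edge of colour \<open>l\<close>.
If every pair of vertices, including pairs \<open>(v, v)\<close>, is covered in this sense by some colour, then a
short case distinction gives some \<open>l\<close> with \<open>(r + 1) \<Sum>Z\<^sub>l \<ge> 2 n\<close> (\<open>half_integral_covers_bound\<close>).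

To pass from edges to \<open>K\<^bsub>a,a\<^esub>\<close>, edges are replaced by pairs \<open>(X, Y)\<close> of vertex sets of
linear size that are dense, in the sense that all subsets of \<open>X\<close> and \<open>Y\<close> of a fixed proportion still span
a \<open>K\<^bsub>a,a\<^esub>\<close>.  A family of dense pairs with bounded overlaps is a fractional packing; it can be rounded,
since the overlap pattern cuts the vertex set into a bounded number of atoms, each atom can
be shared out equally among the pairs containing it (\<open>disjoint_shares\<close>), and the share of a dense pair
is tiled greedily by \<open>K\<^bsub>a,a\<^esub>\<close> (\<open>greedy_tiling\<close>).  An approximately optimal dual weighting comes from
maximising the size of the family minus a convex penalty on the vertex loads: the slope of the
penalty at the load of \<open>v\<close> is the dual weight of \<open>v\<close>.  That no dense pair can be added profitably
says that all dense pairs are covered, and that none can be removed profitably bounds the total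
weight by the size of the packing (\<open>optimal_load\<close>).  Rounding the weights to half-integral ones gives
\<open>half_integral_cover\<close>.

Finally, given such a \<open>Z\<^sub>l\<close> for every colour, classify the vertices by the vector
of the values \<open>Z\<^sub>l\<close>.  There are at most \<open>3\<^sup>r\<close> classes, and those of small size can be ignored.
If two large classes were covered by no colour, no subpair of them would be dense in any
colour.  Passing to subsets once for each colour would then give large sets \<open>X, Y\<close> between
which no colour contains \<open>K\<^bsub>a,a\<^esub>\<close>, which contradicts the bipartite Ramsey theorem.  So
every two vertices in large classes are covered by some colour, and the count above applies
(\<open>monochromatic_packing_bound\<close>).
\<close>

section \<open>Bicliques and dense pairs\<close>

definition biclique :: "('v \<Rightarrow> 'v \<Rightarrow> bool) \<Rightarrow> nat \<Rightarrow> 'v set \<Rightarrow> 'v set \<Rightarrow> bool" where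
  "biclique E a S T \<longleftrightarrow> card S = a \<and> card T = a \<and> (\<forall>u\<in>S. \<forall>v\<in>T. E u v)"

definition has_biclique :: "('v \<Rightarrow> 'v \<Rightarrow> bool) \<Rightarrow> nat \<Rightarrow> 'v set \<Rightarrow> 'v set \<Rightarrow> bool" where
  "has_biclique E a X Y \<longleftrightarrow> (\<exists>S\<subseteq>X. \<exists>T\<subseteq>Y. biclique E a S T)"

text \<open>The consequence of positive density in a regular pair that greedy tiling needs: bicliques survive in
all subsets whose proportion is at least \<open>1 / N\<close>.\<close>

definition dense_pair :: "('v \<Rightarrow> 'v \<Rightarrow> bool) \<Rightarrow> nat \<Rightarrow> nat \<Rightarrow> 'v set \<Rightarrow> 'v set \<Rightarrow> bool" where
  "dense_pair E a N X Y \<longleftrightarrow>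
     (\<forall>X'\<subseteq>X. \<forall>Y'\<subseteq>Y. card X \<le> N * card X' \<and> card Y \<le> N * card Y' \<longrightarrow> has_biclique E a X' Y')"

abbreviation verts :: "'v set \<times> 'v set \<Rightarrow> 'v set" where
  "verts p \<equiv> fst p \<union> snd p"

definition biclique_packing ::
    "('v \<Rightarrow> 'v \<Rightarrow> bool) \<Rightarrow> nat \<Rightarrow> 'v set \<Rightarrow> ('v set \<times> 'v set) set \<Rightarrow> bool" where
  "biclique_packing E a V Q \<longleftrightarrow> finite Q \<and>
     (\<forall>(S, T)\<in>Q. biclique E a S T \<and> S \<inter> T = {} \<and> S \<union> T \<subseteq> V) \<and>
     pairwise (\<lambda>p q. disjnt (verts p) (verts q)) Q"

text \<open>As long as a \<open>1 / N\<close> proportion of the pair is left on both sides, density yields one more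
biclique. Each biclique takes \<open>a\<close> vertices from each side, so that the two sides shrink at the same rate.\<close>

lemma greedy_tiling:
  assumes "dense_pair E a N X Y" and "a \<ge> 1" and "X \<inter> Y = {}" and "card X = z" "card Y = z"
    and "X' \<subseteq> X" "Y' \<subseteq> Y" "finite X" "finite Y" "p \<le> card X'" "p \<le> card Y'"
  shows "\<exists>Q. biclique_packing E a (X' \<union> Y') Q \<and> N * p \<le> N * a * card Q + z"
  using assms(6,7,10,11)
proof (induction p arbitrary: X' Y' rule: less_induct)
  case (less p)
  show ?case
  proof (cases "N * p \<le> z")
    case True
    then show ?thesis
      by (intro exI[of _ "{}"]) (simp add: biclique_packing_def)
  next
    case False
    have fin: "finite X'" "finite Y'"
      using less.prems assms(8,9) finite_subset by blast+
    have "card X \<le> N * card X'" "card Y \<le> N * card Y'"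
      using False less.prems(3,4) assms(4,5) mult_le_mono2[of p "card X'" N] mult_le_mono2[of p "card Y'" N]
      by linarith+
    then obtain S T where ST: "S \<subseteq> X'" "T \<subseteq> Y'" "biclique E a S T"
      using assms(1) less.prems unfolding dense_pair_def has_biclique_def by meson
    have cST: "card S = a" "card T = a" using ST by (auto simp: biclique_def)
    have disj: "S \<inter> T = {}" using ST less.prems assms(3) by blast
    have "p - a < p" using False assms(2) by (cases p) auto
    moreover have "p - a \<le> card (X' - S)" "p - a \<le> card (Y' - T)"
      using card_Diff_subset[of S X'] card_Diff_subset[of T Y'] ST fin finite_subset cST less.prems
      by (metis diff_le_mono)+
    ultimately obtain Q where Q: "biclique_packing E a ((X' - S) \<union> (Y' - T)) Q"
        "N * (p - a) \<le> N * a * card Q + z"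
      using less.IH[of "p - a" "X' - S" "Y' - T"] less.prems by blast
    have "(S, T) \<notin> Q"
    proof
      assume "(S, T) \<in> Q"
      then have "S \<union> T \<subseteq> (X' - S) \<union> (Y' - T)" using Q by (auto simp: biclique_packing_def)
      moreover have "S \<noteq> {}" using cST assms(2) by auto
      ultimately show False using less.prems ST assms(3) by blast
    qed
    then have c: "card (insert (S, T) Q) = Suc (card Q)"
      using Q by (auto simp: biclique_packing_def)
    have away: "disjnt (S \<union> T) (verts q)" if "q \<in> Q" for q
    proof -
      have "verts q \<subseteq> (X' - S) \<union> (Y' - T)" using Q that
        by (fastforce simp: biclique_packing_def)
      then show ?thesis using less.prems ST assms(3) unfolding disjnt_def by blast
    qed
    have "biclique_packing E a (X' \<union> Y') (insert (S, T) Q)"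
    proof -
      have Q': "finite Q" "pairwise (\<lambda>p q. disjnt (verts p) (verts q)) Q"
        "\<forall>(S', T')\<in>Q. biclique E a S' T' \<and> S' \<inter> T' = {} \<and> S' \<union> T' \<subseteq> (X' - S) \<union> (Y' - T)"
        using Q(1) by (simp_all add: biclique_packing_def)
      have "biclique E a S' T' \<and> S' \<inter> T' = {} \<and> S' \<union> T' \<subseteq> X' \<union> Y'"
        if "(S', T') \<in> insert (S, T) Q" for S' T'
      proof (cases "(S', T') = (S, T)")
        case True
        then show ?thesis using ST disj by auto
      next
        case False
        then show ?thesis using Q'(3) that by blast
      qed
      moreover have "pairwise (\<lambda>p q. disjnt (verts p) (verts q)) (insert (S, T) Q)"
        unfolding pairwise_insert using Q'(2) away by (auto simp: disjnt_sym)
      ultimately show ?thesis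
        using Q'(1) unfolding biclique_packing_def by blast
    qed
    moreover have "N * p \<le> N * a * card (insert (S, T) Q) + z"
    proof -
      have "N * p \<le> N * (p - a) + N * a"
        by (metis add_mult_distrib2 le_diff_conv mult_le_mono2 order_refl)
      then show ?thesis using Q(2) c by (simp add: algebra_simps)
    qed
    ultimately show ?thesis by blast
  qed
qed

section \<open>Sharing out overlapping sets\<close>

lemma residue_class_card:
  assumes "(i::nat) < N"
  shows "M div N \<le> card {j. j < M \<and> j mod N = i}"
proof -
  have "inj_on (\<lambda>k. k * N + i) {..<M div N}"
    using assms by (auto simp: inj_on_def)
  moreover have "(\<lambda>k. k * N + i) ` {..<M div N} \<subseteq> {j. j < M \<and> j mod N = i}"
  proof clarsimp
    fix k assume "k < M div N"
    then have "Suc k * N \<le> M div N * N" by (metis Suc_leI mult_le_mono1)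
    also have "\<dots> \<le> M" by simp
    finally show "k * N + i < M \<and> i mod N = i" using assms by simp
  qed
  ultimately have "card {..<M div N} \<le> card {j. j < M \<and> j mod N = i}"
    by (rule card_inj_on_le) simp
  then show ?thesis by simp
qed

lemma equidistributed_labelling:
  fixes key :: "'v \<Rightarrow> 'k"
  assumes "finite V" "N \<ge> 1"
  shows "\<exists>f::'v \<Rightarrow> nat. \<forall>z. \<forall>i<N. card {v\<in>V. key v = z} \<le> N * card {v\<in>V. key v = z \<and> f v = i} + N"
proof -
  define Z where "Z z = {v\<in>V. key v = z}" for z
  have "\<forall>z. \<exists>h. bij_betw h (Z z) {0..<card (Z z)}"
    using assms by (auto simp: Z_def intro!: ex_bij_betw_finite_nat)
  from choice[OF this] obtain h where h: "\<forall>z. bij_betw (h z) (Z z) {0..<card (Z z)}" by blast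
  define f where "f v = h (key v) v mod N" for v
  have "card (Z z) \<le> N * card {v\<in>V. key v = z \<and> f v = i} + N" if "i < N" for z i
  proof -
    have "{j. j < card (Z z) \<and> j mod N = i} \<subseteq> h z ` {v\<in>V. key v = z \<and> f v = i}"
    proof
      fix j assume j: "j \<in> {j. j < card (Z z) \<and> j mod N = i}"
      then have "j \<in> h z ` Z z" using h by (auto simp: bij_betw_def)
      then obtain v where "v \<in> Z z" "h z v = j" by blast
      then show "j \<in> h z ` {v\<in>V. key v = z \<and> f v = i}"
        using j by (auto simp: Z_def f_def)
    qed
    moreover have "finite {v\<in>V. key v = z \<and> f v = i}" using assms(1) by simp
    ultimately have "card {j. j < card (Z z) \<and> j mod N = i} \<le> card {v\<in>V. key v = z \<and> f v = i}"
      by (rule surj_card_le[rotated])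
    with residue_class_card[OF that, of "card (Z z)"]
    have "card (Z z) div N \<le> card {v\<in>V. key v = z \<and> f v = i}" by linarith
    then have "N * (card (Z z) div N) \<le> N * card {v\<in>V. key v = z \<and> f v = i}" by simp
    moreover have "card (Z z) mod N < N" using assms by simp
    ultimately show ?thesis
      using mult_div_mod_eq[of N "card (Z z)"] by linarith
  qed
  then show ?thesis unfolding Z_def by blast
qed

text \<open>
Overlapping sets, at most \<open>N\<close> of them through any point, can be replaced by disjoint subsets that
keep a proportion \<open>1 / N\<close> up to an additive constant. Points with the same set \<open>K\<close> of
indices form an atom. Inside an atom the \<open>N\<close> labels are equidistributed, and a fixed injection
of \<open>K\<close> into the labels decides which label is the share of which index. An error of at most one arises
per label and atom, which accounts for the term \<open>2 ^ card I\<close>.\<close>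

lemma disjoint_shares:
  fixes S :: "'i \<Rightarrow> 'v set"
  assumes "finite V" "finite I" "N \<ge> 1" and S: "\<And>i. i \<in> I \<Longrightarrow> S i \<subseteq> V"
    and few: "\<And>v. v \<in> V \<Longrightarrow> card {i\<in>I. v \<in> S i} \<le> N"
  shows "\<exists>S'. (\<forall>i\<in>I. S' i \<subseteq> S i \<and> card (S i) \<le> N * card (S' i) + N * 2 ^ card I)
            \<and> disjoint_family_on S' I"
proof -
  define key where "key v = {i\<in>I. v \<in> S i}" for v
  obtain f :: "'v \<Rightarrow> nat" where f: "\<And>z i. i < N \<Longrightarrow>
      card {v\<in>V. key v = z} \<le> N * card {v\<in>V. key v = z \<and> f v = i} + N"
    using equidistributed_labelling[OF assms(1,3), of key] by blast
  have "\<exists>g::'i \<Rightarrow> nat. inj_on g K \<and> g ` K \<subseteq> {..<N}" if "K \<subseteq> I" "card K \<le> N" for K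
  proof -
    have "finite K" using that assms(2) finite_subset by blast
    from ex_bij_betw_finite_nat[OF this] obtain g where "bij_betw g K {0..<card K}" by blast
    then show ?thesis using that(2) by (intro exI[of _ g]) (auto simp: bij_betw_def)
  qed
  note ex_pos = this
  define pos :: "'i set \<Rightarrow> 'i \<Rightarrow> nat" where
    "pos K = (SOME g. inj_on g K \<and> g ` K \<subseteq> {..<N})" for K
  have pos: "inj_on (pos K) K \<and> pos K ` K \<subseteq> {..<N}" if "K \<subseteq> I" "card K \<le> N" for K
    unfolding pos_def by (rule someI_ex[OF ex_pos[OF that]])
  have key: "key v \<subseteq> I" "v \<in> V \<Longrightarrow> card (key v) \<le> N" for v
    using few by (auto simp: key_def)
  define S' where "S' i = {v \<in> S i. f v = pos (key v) i}" for i
  have "card (S i) \<le> N * card (S' i) + N * 2 ^ card I" if i: "i \<in> I" for i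
  proof -
    define KK where "KK = {K. K \<in> key ` V \<and> i \<in> K}"
    have KK: "KK \<subseteq> Pow I" using key by (auto simp: KK_def)
    then have finKK: "finite KK" "card KK \<le> 2 ^ card I"
      using assms(2) finite_subset card_mono[of "Pow I" KK] card_Pow[of I] by auto
    have "S i = (\<Union>K\<in>KK. {v\<in>V. key v = K})"
      using S[OF i] i by (auto simp: KK_def key_def)
    then have "card (S i) \<le> (\<Sum>K\<in>KK. card {v\<in>V. key v = K})"
      using card_UN_le[OF finKK(1)] by metis
    also have "\<dots> \<le> (\<Sum>K\<in>KK. N * card {v\<in>V. key v = K \<and> f v = pos K i} + N)"
    proof (rule sum_mono)
      fix K assume "K \<in> KK"
      then have "pos K i < N" using pos[of K] key by (auto simp: KK_def)
      then show "card {v\<in>V. key v = K} \<le> N * card {v\<in>V. key v = K \<and> f v = pos K i} + N"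
        by (rule f)
    qed
    also have "\<dots> = N * (\<Sum>K\<in>KK. card {v\<in>V. key v = K \<and> f v = pos K i}) + N * card KK"
      by (simp add: sum.distrib sum_distrib_left)
    also have "(\<Sum>K\<in>KK. card {v\<in>V. key v = K \<and> f v = pos K i})
        = card (\<Union>K\<in>KK. {v\<in>V. key v = K \<and> f v = pos K i})"
      using finKK assms(1) by (subst card_UN_disjoint) auto
    also have "(\<Union>K\<in>KK. {v\<in>V. key v = K \<and> f v = pos K i}) = S' i"
      using S[OF i] i by (auto simp: KK_def S'_def key_def)
    finally show ?thesis
      using finKK(2) by (meson add_left_mono le_trans mult_le_mono2)
  qed
  moreover have "S' i \<inter> S' j = {}" if "i \<in> I" "j \<in> I" "i \<noteq> j" for i j
  proof (rule ccontr)
    assume "S' i \<inter> S' j \<noteq> {}"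
    then obtain v where "v \<in> S' i" "v \<in> S' j" by blast
    then have v: "v \<in> S i" "v \<in> S j" "pos (key v) i = pos (key v) j"
      unfolding S'_def by simp_all
    then have "v \<in> V" "i \<in> key v" "j \<in> key v" using S that by (auto simp: key_def)
    then show False using pos[of "key v"] key v(3) that(3) by (auto dest: inj_onD)
  qed
  ultimately show ?thesis
    unfolding disjoint_family_on_def by (intro exI[of _ S'] conjI ballI impI) (simp_all add: S'_def)
qed

section \<open>Approximate duality for packings of pairs\<close>

definition load :: "('v set \<times> 'v set) multiset \<Rightarrow> 'v \<Rightarrow> nat" where
  "load P v = size {#p \<in># P. v \<in> verts p#}"

lemma load_add_mset: "load (add_mset p P) v = load P v + of_bool (v \<in> verts p)"
  by (simp add: load_def)

lemma sum_load:
  fixes g :: "'v \<Rightarrow> nat"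
  assumes "finite V" "\<And>p. p \<in># P \<Longrightarrow> verts p \<subseteq> V"
  shows "(\<Sum>p\<in>#P. \<Sum>v\<in>verts p. g v) = (\<Sum>v\<in>V. load P v * g v)"
  using assms(2)
proof (induction P)
  case empty
  then show ?case by (simp add: load_def)
next
  case (add p P)
  have "(\<Sum>v\<in>V. of_bool (v \<in> verts p) * g v) = (\<Sum>v\<in>V \<inter> verts p. g v)"
    unfolding sum.inter_restrict[OF assms(1)] by (intro sum.cong) auto
  also have "V \<inter> verts p = verts p" using add.prems[of p] by auto
  finally have "(\<Sum>v\<in>V. load (add_mset p P) v * g v)
      = (\<Sum>v\<in>V. load P v * g v) + (\<Sum>v\<in>verts p. g v)"
    by (simp add: load_add_mset algebra_simps sum.distrib)
  then show ?case using add by simp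
qed

text \<open>Approximate linear programming duality for packing pairs from \<open>D\<close>, where \<open>load P v - s\<^sup>2\<close> (truncated at 0)
is \<open>s\<close> times the dual weight of \<open>v\<close>. Take \<open>P\<close> to maximise \<open>s\<close> times \<open>\<Sum>p\<in>#P. card (fst p)\<close> minus \<open>\<Sum>\<^sub>v G (load P v)\<close>, where
\<open>G\<close> is convex with slope \<open>j - s\<^sup>2\<close> at \<open>j\<close>. An uncovered pair could be added with profit. No vertex of
it has weight \<open>s\<close>, so the upper bound \<open>s\<^sup>2 + s\<close> on the loads does not stand in the way. Conversely, removing a pair of \<open>P\<close> must not be
profitable, which bounds the weight on that pair; summing over \<open>P\<close> counts the weight of
each vertex with the factor \<open>load P v\<close>. As the weight vanishes unless the load exceeds
\<open>s\<^sup>2\<close>, that factor is between \<open>s\<^sup>2\<close> and \<open>s\<^sup>2 + s\<close>, hence nearly constant. This is why the penalty sets in late.\<close>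

lemma optimal_load:
  fixes V :: "'v set" and s :: nat
  assumes fin: "finite V" and s: "s \<ge> 1"
    and D: "\<And>X Y. (X, Y) \<in> D \<Longrightarrow> X \<inter> Y = {} \<and> card X = card Y \<and> X \<noteq> {} \<and> X \<union> Y \<subseteq> V"
  obtains P where "set_mset P \<subseteq> D" and "\<And>v. load P v \<le> s\<^sup>2 + s"
    and "\<And>X Y. (X, Y) \<in> D \<Longrightarrow> \<exists>u\<in>X. \<exists>v\<in>Y. s \<le> (load P u - s\<^sup>2) + (load P v - s\<^sup>2)"
    and "s * (\<Sum>v\<in>V. load P v - s\<^sup>2) \<le> s * card V + (\<Sum>p\<in>#P. card (fst p))"
proof -
  define G :: "nat \<Rightarrow> nat" where "G j = (\<Sum>i<j. i - s\<^sup>2)" for j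
  define pen where "pen P = (\<Sum>v\<in>V. G (load P v))" for P
  define gain where "gain P = s * (\<Sum>p\<in>#P. card (fst p))" for P :: "('v set \<times> 'v set) multiset"
  define feas where "feas P \<longleftrightarrow> set_mset P \<subseteq> D \<and> (\<forall>v. load P v \<le> s\<^sup>2 + s)" for P
  define bound where "bound = s * ((s\<^sup>2 + s) * card V)"
  have Dp: "verts p \<subseteq> V" "fst p \<inter> snd p = {}" "card (fst p) = card (snd p)"
    "finite (fst p)" "finite (snd p)" if "p \<in> D" for p
    using D[of "fst p" "snd p"] that fin finite_subset by auto
  have gain_le: "gain P \<le> bound" if "feas P" for P
  proof -
    have PD: "p \<in> D" if "p \<in># P" for p using \<open>feas P\<close> that by (auto simp: feas_def)
    have "(\<Sum>p\<in>#P. card (fst p)) \<le> (\<Sum>p\<in>#P. \<Sum>v\<in>verts p. 1)"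
      using Dp PD by (intro sum_mset_mono) (simp add: card_Un_disjoint)
    also have "\<dots> = (\<Sum>v\<in>V. load P v * 1)"
      using Dp(1) PD fin by (intro sum_load) auto
    also have "\<dots> \<le> (\<Sum>v\<in>V. s\<^sup>2 + s)"
      using that by (intro sum_mono) (auto simp: feas_def)
    also have "\<dots> = (s\<^sup>2 + s) * card V" by simp
    finally show ?thesis unfolding gain_def bound_def by (rule mult_le_mono2)
  qed
  have "feas {#}" by (simp add: feas_def load_def)
  then obtain P where P: "feas P"
    and least: "\<And>P'. feas P' \<Longrightarrow> bound + pen P - gain P \<le> bound + pen P' - gain P'"
    using ex_has_least_nat[of feas _ "\<lambda>P. bound + pen P - gain P"] by blast
  have opt: "gain P' + pen P \<le> gain P + pen P'" if "feas P'" for P'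
    using least[OF that] gain_le[OF that] gain_le[OF P] by linarith
  have gain_add: "gain (add_mset p P) = gain P + s * card (fst p)" for p P
    by (simp add: gain_def algebra_simps)
  have pen_add: "pen (add_mset p P) = pen P + (\<Sum>v\<in>verts p. load P v - s\<^sup>2)" if "p \<in> D" for p P
  proof -
    have "pen (add_mset p P) = (\<Sum>v\<in>V. G (load P v) + (if v \<in> verts p then load P v - s\<^sup>2 else 0))"
      unfolding pen_def by (intro sum.cong refl) (simp add: load_add_mset G_def)
    also have "\<dots> = pen P + (\<Sum>v\<in>V \<inter> verts p. load P v - s\<^sup>2)"
      using fin by (simp add: pen_def sum.distrib sum.inter_restrict)
    also have "V \<inter> verts p = verts p" using Dp(1)[OF that] by auto
    finally show ?thesis .
  qed
  \<comment> \<open>adding a pair does not pay\<close>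
  have cover: "\<exists>u\<in>X. \<exists>v\<in>Y. s \<le> (load P u - s\<^sup>2) + (load P v - s\<^sup>2)" if XY: "(X, Y) \<in> D" for X Y
  proof (rule ccontr)
    assume "\<not> ?thesis"
    then have low: "\<And>u v. u \<in> X \<Longrightarrow> v \<in> Y \<Longrightarrow> (load P u - s\<^sup>2) + (load P v - s\<^sup>2) < s"
      by (meson not_le)
    have fXY: "finite X" "finite Y" "card X = card Y" "X \<inter> Y = {}" "X \<noteq> {}"
      using Dp[OF XY] D[OF XY] by auto
    then have "Y \<noteq> {}" by auto
    let ?w = "\<lambda>v. load P v - s\<^sup>2"
    obtain u0 where u0: "u0 \<in> X" "?w u0 = Max (?w ` X)"
      using Max_in[of "?w ` X"] fXY by fastforce
    obtain v0 where v0: "v0 \<in> Y" "?w v0 = Max (?w ` Y)"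
      using Max_in[of "?w ` Y"] fXY \<open>Y \<noteq> {}\<close> by fastforce
    have u0': "?w u \<le> ?w u0" if "u \<in> X" for u using u0 fXY that by simp
    have v0': "?w v \<le> ?w v0" if "v \<in> Y" for v using v0 fXY that by simp
    have "load P v < s\<^sup>2 + s" if "v \<in> X \<union> Y" for v
      using low[of v v0] low[of u0 v] u0(1) v0(1) that s by force
    then have "load (add_mset (X, Y) P) v \<le> s\<^sup>2 + s" for v
      using P by (force simp: load_add_mset feas_def of_bool_def)
    then have "feas (add_mset (X, Y) P)" using P XY by (auto simp: feas_def)
    from opt[OF this] have "s * card X \<le> (\<Sum>v\<in>X \<union> Y. ?w v)"
      using gain_add[of "(X, Y)" P] pen_add[OF XY, of P] by simp
    also have "\<dots> = (\<Sum>v\<in>X. ?w v) + (\<Sum>v\<in>Y. ?w v)"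
      using fXY by (simp add: sum.union_disjoint)
    also have "\<dots> \<le> card X * ?w u0 + card X * ?w v0"
      using sum_bounded_above[of X ?w "?w u0"] sum_bounded_above[of Y ?w "?w v0"] u0' v0' fXY(3)
      by (intro add_mono) auto
    also have "\<dots> = card X * (?w u0 + ?w v0)" by (simp only: distrib_left)
    also have "\<dots> < card X * s"
      using low[OF u0(1) v0(1)] fXY by (intro mult_strict_left_mono) (auto simp: card_gt_0_iff)
    finally show False by (simp add: mult.commute)
  qed
  \<comment> \<open>removing a pair does not pay; the slope that counts is the one at \<open>load P v - 1\<close>\<close>
  have "(\<Sum>v\<in>V. load P v * (load P v - 1 - s\<^sup>2)) = (\<Sum>p\<in>#P. \<Sum>v\<in>verts p. load P v - 1 - s\<^sup>2)"
    using Dp(1) P fin by (intro sum_load[symmetric]) (auto simp: feas_def)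
  also have "\<dots> \<le> (\<Sum>p\<in>#P. s * card (fst p))"
  proof (rule sum_mset_mono)
    fix p assume p: "p \<in># P"
    then obtain P' where P': "P = add_mset p P'" by (meson multi_member_split)
    have pD: "p \<in> D" using p P by (auto simp: feas_def)
    have "load P' v \<le> load P v" for v by (simp add: P' load_add_mset)
    then have "feas P'" using P P' by (auto simp: feas_def intro: order_trans)
    from opt[OF this] have "(\<Sum>v\<in>verts p. load P' v - s\<^sup>2) \<le> s * card (fst p)"
      unfolding P' pen_add[OF pD] gain_add by simp
    moreover have "(\<Sum>v\<in>verts p. load P' v - s\<^sup>2) = (\<Sum>v\<in>verts p. load P v - 1 - s\<^sup>2)"
      by (intro sum.cong refl) (simp add: P' load_add_mset)
    ultimately show "(\<Sum>v\<in>verts p. load P v - 1 - s\<^sup>2) \<le> s * card (fst p)" by simp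
  qed
  also have "\<dots> = s * (\<Sum>p\<in>#P. card (fst p))" by (simp add: sum_mset_distrib_left)
  finally have rem: "(\<Sum>v\<in>V. load P v * (load P v - 1 - s\<^sup>2)) \<le> s * (\<Sum>p\<in>#P. card (fst p))" .
  have "s\<^sup>2 * (\<Sum>v\<in>V. load P v - s\<^sup>2) = (\<Sum>v\<in>V. s\<^sup>2 * (load P v - s\<^sup>2))"
    by (simp add: sum_distrib_left)
  also have "\<dots> \<le> (\<Sum>v\<in>V. s\<^sup>2 + load P v * (load P v - 1 - s\<^sup>2))"
  proof (rule sum_mono)
    fix v
    show "s\<^sup>2 * (load P v - s\<^sup>2) \<le> s\<^sup>2 + load P v * (load P v - 1 - s\<^sup>2)"
    proof (cases "load P v \<le> s\<^sup>2")
      case False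
      then obtain k where k: "load P v = s\<^sup>2 + 1 + k"
        by (metis Suc_eq_plus1 add.commute add_Suc_right le_add_diff_inverse2 not_less_eq_eq)
      have "s\<^sup>2 * k \<le> load P v * k" using False by (intro mult_le_mono1) simp
      then show ?thesis by (simp add: k algebra_simps)
    qed simp
  qed
  also have "\<dots> \<le> s\<^sup>2 * card V + s * (\<Sum>p\<in>#P. card (fst p))"
    using rem by (simp add: sum.distrib)
  finally have "s * (s * (\<Sum>v\<in>V. load P v - s\<^sup>2)) \<le> s * (s * card V + (\<Sum>p\<in>#P. card (fst p)))"
    by (simp add: power2_eq_square algebra_simps)
  then have "s * (\<Sum>v\<in>V. load P v - s\<^sup>2) \<le> s * card V + (\<Sum>p\<in>#P. card (fst p))"
    using s by simp
  moreover have "set_mset P \<subseteq> D" "\<And>v. load P v \<le> s\<^sup>2 + s" using P by (auto simp: feas_def)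
  ultimately show thesis using that cover by blast
qed

text \<open>Threshold rounding: \<open>Z\<close> counts which of the two complementary thresholds \<open>\<theta>\<close> and \<open>s + 1 - \<theta>\<close> the value
\<open>Y v\<close> reaches. If \<open>Y u + Y v \<ge> s\<close>, then \<open>u\<close> reaches one of them or \<open>v\<close> reaches the other, for either order, so every
threshold preserves covered pairs. On average over \<open>\<theta> \<in> {1..s}\<close> the total is \<open>2 / s\<close> times that of \<open>Y\<close>.\<close>

lemma half_integral_rounding:
  fixes Y :: "'v \<Rightarrow> nat"
  assumes s: "s \<ge> 1" and Y: "\<And>v. Y v \<le> s"
  obtains Z :: "'v \<Rightarrow> nat" where "\<And>v. Z v \<le> 2" and "s * (\<Sum>v\<in>V. Z v) \<le> 2 * (\<Sum>v\<in>V. Y v)"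
    and "\<And>u v. s \<le> Y u + Y v \<Longrightarrow> 2 \<le> Z u + Z v"
proof -
  define Z :: "nat \<Rightarrow> 'v \<Rightarrow> nat" where
    "Z \<theta> v = of_bool (\<theta> \<le> Y v) + of_bool (s + 1 - \<theta> \<le> Y v)" for \<theta> v
  have one: "(\<Sum>\<theta>=1..s. of_bool (\<theta> \<le> Y v)) = Y v" for v
  proof -
    have "(\<Sum>\<theta>=1..s. of_bool (\<theta> \<le> Y v)) = card ({1..s} \<inter> {\<theta>. \<theta> \<le> Y v})"
      by (simp add: Int_def flip: sum.inter_filter)
    also have "{1..s} \<inter> {\<theta>. \<theta> \<le> Y v} = {1..Y v}" using Y[of v] by auto
    finally show ?thesis by simp
  qed
  have two: "(\<Sum>\<theta>=1..s. of_bool (s + 1 - \<theta> \<le> Y v)) = Y v" for v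
    using sum.atLeastAtMost_rev[of "\<lambda>\<theta>. of_bool (\<theta> \<le> Y v) :: nat" 1 s] one[of v]
    by (simp only: add.commute)
  have "(\<Sum>\<theta>=1..s. \<Sum>v\<in>V. Z \<theta> v) = (\<Sum>v\<in>V. \<Sum>\<theta>=1..s. Z \<theta> v)" by (rule sum.swap)
  also have "\<dots> = 2 * (\<Sum>v\<in>V. Y v)"
    unfolding Z_def sum.distrib one two by simp
  finally have total: "(\<Sum>\<theta>=1..s. \<Sum>v\<in>V. Z \<theta> v) = 2 * (\<Sum>v\<in>V. Y v)" .
  have "\<exists>\<theta>\<in>{1..s}. s * (\<Sum>v\<in>V. Z \<theta> v) \<le> 2 * (\<Sum>v\<in>V. Y v)"
  proof (rule ccontr)
    assume "\<not> ?thesis"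
    then have "(\<Sum>\<theta>=1..s. 2 * (\<Sum>v\<in>V. Y v)) < (\<Sum>\<theta>=1..s. s * (\<Sum>v\<in>V. Z \<theta> v))"
      using s by (intro sum_strict_mono) (auto simp: not_le)
    then show False using total by (simp flip: sum_distrib_left)
  qed
  then obtain \<theta> where \<theta>: "\<theta> \<in> {1..s}" "s * (\<Sum>v\<in>V. Z \<theta> v) \<le> 2 * (\<Sum>v\<in>V. Y v)" by blast
  have "2 \<le> Z \<theta> u + Z \<theta> v" if "s \<le> Y u + Y v" for u v
    using that \<theta>(1) unfolding Z_def of_bool_def by auto
  moreover have "Z \<theta> v \<le> 2" for v by (simp add: Z_def)
  ultimately show thesis using that \<theta>(2) by blast
qed

section \<open>Integral packings and half-integral covers\<close>

lemma biclique_packing_Union: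
  assumes "finite I" and pack: "\<And>i. i \<in> I \<Longrightarrow> biclique_packing E a (W i) (Q i)"
    and disj: "disjoint_family_on W I" and "\<And>i. i \<in> I \<Longrightarrow> W i \<subseteq> V" and "a \<ge> 1"
  shows "biclique_packing E a V (\<Union>i\<in>I. Q i)" and "card (\<Union>i\<in>I. Q i) = (\<Sum>i\<in>I. card (Q i))"
proof -
  have Q: "finite (Q i)" "pairwise (\<lambda>p q. disjnt (verts p) (verts q)) (Q i)"
    and mem: "\<And>p. p \<in> Q i \<Longrightarrow> biclique E a (fst p) (snd p) \<and> fst p \<inter> snd p = {} \<and> verts p \<subseteq> W i"
    if "i \<in> I" for i
    using pack[OF that] by (auto simp: biclique_packing_def split_beta)
  have cross: "verts p \<inter> verts q = {}" if "i \<in> I" "j \<in> I" "i \<noteq> j" "p \<in> Q i" "q \<in> Q j" for i j p q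
  proof -
    have "W i \<inter> W j = {}" using disj that by (auto simp: disjoint_family_on_def)
    then show ?thesis using mem[OF that(1,4)] mem[OF that(2,5)] by blast
  qed
  have "pairwise (\<lambda>p q. disjnt (verts p) (verts q)) (\<Union>i\<in>I. Q i)"
  proof (rule pairwiseI)
    fix p q assume "p \<in> (\<Union>i\<in>I. Q i)" "q \<in> (\<Union>i\<in>I. Q i)" and neq: "p \<noteq> q"
    then obtain i j where ij: "i \<in> I" "p \<in> Q i" "j \<in> I" "q \<in> Q j" by blast
    show "disjnt (verts p) (verts q)"
    proof (cases "i = j")
      case True
      then show ?thesis using Q(2)[OF ij(1)] ij neq by (auto simp: pairwise_def)
    next
      case False
      then show ?thesis using cross[OF ij(1,3) False ij(2,4)] by (simp add: disjnt_def)
    qed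
  qed
  moreover have "finite (\<Union>i\<in>I. Q i)" using assms(1) Q(1) by blast
  moreover have "biclique E a S T \<and> S \<inter> T = {} \<and> S \<union> T \<subseteq> V" if "(S, T) \<in> (\<Union>i\<in>I. Q i)" for S T
  proof -
    from that obtain i where "i \<in> I" "(S, T) \<in> Q i" by blast
    then show ?thesis using mem[of i "(S, T)"] assms(4)[of i] by auto
  qed
  ultimately show "biclique_packing E a V (\<Union>i\<in>I. Q i)"
    unfolding biclique_packing_def by blast
  have "Q i \<inter> Q j = {}" if "i \<in> I" "j \<in> I" "i \<noteq> j" for i j
  proof (rule ccontr)
    assume "Q i \<inter> Q j \<noteq> {}"
    then obtain p where p: "p \<in> Q i" "p \<in> Q j" by blast
    then have "verts p = {}" using cross[OF that p] by blast
    moreover have "card (fst p) = a" using mem[OF that(1) p(1)] by (simp add: biclique_def)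
    ultimately show False using assms(5) by auto
  qed
  then show "card (\<Union>i\<in>I. Q i) = (\<Sum>i\<in>I. card (Q i))"
    using assms(1) Q(1) by (intro card_UN_disjoint) auto
qed

text \<open>Both sides of all the pairs, \<open>2 * size P\<close> sets in total, are shared out at once; a vertex lies in at most
one side of each pair. The share of each pair is large enough for the greedy tiling to leave
only a proportion \<open>1 / s\<close> of it, since density is required with the parameter \<open>s * N\<close>.\<close>

lemma round_fractional_packing:
  fixes V :: "'v set"
  assumes fin: "finite V" and a: "a \<ge> 1" and N: "N \<ge> 1" and s: "s \<ge> 1"
    and P: "\<And>X Y. (X, Y) \<in># P \<Longrightarrow> X \<inter> Y = {} \<and> card X = card Y \<and> X \<union> Y \<subseteq> V
              \<and> dense_pair E a (s * N) X Y"
    and few: "\<And>v. load P v \<le> N"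
  obtains Q where "biclique_packing E a V Q"
    and "s * (\<Sum>p\<in>#P. card (fst p))
           \<le> s * N * a * card Q + (\<Sum>p\<in>#P. card (fst p)) + s * N * size P * 4 ^ size P"
proof -
  obtain ps where ps: "mset ps = P" using ex_mset by blast
  define K where "K = length ps"
  define I where "I = {..<K} \<times> (UNIV :: bool set)"
  define S where "S i = (if snd i then fst (ps ! fst i) else snd (ps ! fst i))" for i :: "nat \<times> bool"
  have [simp]: "size P = K" by (simp add: K_def flip: ps)
  have pk: "ps ! k \<in># P" if "k < K" for k using that by (simp add: K_def flip: ps)
  have Pk: "fst (ps ! k) \<inter> snd (ps ! k) = {}" "card (fst (ps ! k)) = card (snd (ps ! k))"
    "verts (ps ! k) \<subseteq> V" "dense_pair E a (s * N) (fst (ps ! k)) (snd (ps ! k))" if "k < K" for k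
    using P[of "fst (ps ! k)" "snd (ps ! k)"] pk[OF that] by auto
  have "finite I" by (simp add: I_def)
  have cI: "card I = 2 * K" by (simp add: I_def card_cartesian_product)
  have "S i \<subseteq> V" if "i \<in> I" for i using Pk(3)[of "fst i"] that by (auto simp: I_def S_def)
  moreover have "card {i\<in>I. v \<in> S i} \<le> N" for v
  proof -
    have "card {i\<in>I. v \<in> S i} \<le> card {k. k < K \<and> v \<in> verts (ps ! k)}"
    proof (rule card_inj_on_le)
      show "inj_on fst {i\<in>I. v \<in> S i}"
      proof (rule inj_onI)
        fix i j assume ij: "i \<in> {i\<in>I. v \<in> S i}" "j \<in> {i\<in>I. v \<in> S i}" "fst i = fst j"
        then have "fst i < K" by (auto simp: I_def)
        from Pk(1)[OF this] have "fst (ps ! fst i) \<inter> snd (ps ! fst i) = {}" .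
        then have "snd i = snd j" using ij by (auto simp: S_def split: if_splits)
        then show "i = j" using ij(3) by (simp add: prod_eq_iff)
      qed
    qed (auto simp: I_def S_def split: if_splits)
    also have "\<dots> = load P v"
      unfolding load_def by (simp add: K_def length_filter_conv_card flip: ps mset_filter)
    finally show ?thesis using few[of v] by simp
  qed
  ultimately obtain S' where S': "\<And>i. i \<in> I \<Longrightarrow> S' i \<subseteq> S i \<and> card (S i) \<le> N * card (S' i) + N * 2 ^ card I"
    and dS': "disjoint_family_on S' I"
    using disjoint_shares[OF fin \<open>finite I\<close> N, of S] by blast
  define W where "W k = S' (k, True) \<union> S' (k, False)" for k
  have "\<exists>q. biclique_packing E a (W k) q \<and>
          s * card (fst (ps ! k)) \<le> s * N * a * card q + card (fst (ps ! k)) + s * N * 4 ^ K"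
    if k: "k < K" for k
  proof -
    let ?X = "fst (ps ! k)" and ?Y = "snd (ps ! k)"
    define z where "z = card ?X"
    define p where "p = min (card (S' (k, True))) (card (S' (k, False)))"
    have "(k, True) \<in> I" "(k, False) \<in> I" using k by (auto simp: I_def)
    note T = S'[OF this(1)] S'[OF this(2)]
    have "finite ?X" "finite ?Y" using Pk(3)[OF k] fin finite_subset by auto
    moreover have "S' (k, True) \<subseteq> ?X" "S' (k, False) \<subseteq> ?Y" "card ?X = z" "card ?Y = z"
      "p \<le> card (S' (k, True))" "p \<le> card (S' (k, False))"
      using T Pk(2)[OF k] by (auto simp: S_def z_def p_def)
    ultimately obtain q where q: "biclique_packing E a (W k) q" "(s * N) * p \<le> (s * N) * a * card q + z"
      using greedy_tiling[OF Pk(4)[OF k] a Pk(1)[OF k]] unfolding W_def by blast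
    have "z \<le> N * p + N * 2 ^ card I"
      using T Pk(2)[OF k] by (auto simp: S_def z_def p_def min_def)
    moreover have "(2::nat) ^ card I = 4 ^ K" by (simp add: cI power_mult)
    ultimately have "s * z \<le> s * (N * p + N * 4 ^ K)" by simp
    then have "s * z \<le> (s * N) * p + s * N * 4 ^ K"
      by (simp add: algebra_simps)
    then have "s * z \<le> s * N * a * card q + z + s * N * 4 ^ K" using q(2) by linarith
    then show ?thesis using q(1) by (auto simp: z_def)
  qed
  then have "\<forall>k. \<exists>q. k < K \<longrightarrow> biclique_packing E a (W k) q \<and>
      s * card (fst (ps ! k)) \<le> s * N * a * card q + card (fst (ps ! k)) + s * N * 4 ^ K"
    by blast
  from choice[OF this] obtain q where q: "\<And>k. k < K \<Longrightarrow> biclique_packing E a (W k) (q k)"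
    and qc: "\<And>k. k < K \<Longrightarrow>
      s * card (fst (ps ! k)) \<le> s * N * a * card (q k) + card (fst (ps ! k)) + s * N * 4 ^ K"
    by blast
  have W_disj: "disjoint_family_on W {..<K}"
    unfolding disjoint_family_on_def
  proof (intro ballI impI)
    fix j k assume "j \<in> {..<K}" "k \<in> {..<K}" "j \<noteq> k"
    then have "S' (j, b) \<inter> S' (k, c) = {}" for b c
      using dS' by (auto simp: disjoint_family_on_def I_def)
    then show "W j \<inter> W k = {}" unfolding W_def by blast
  qed
  have "W k \<subseteq> V" if "k < K" for k
  proof -
    have "(k, True) \<in> I" "(k, False) \<in> I" using that by (auto simp: I_def)
    then have "S' (k, True) \<subseteq> S (k, True)" "S' (k, False) \<subseteq> S (k, False)"
      using S' by blast+
    then have "W k \<subseteq> verts (ps ! k)" by (auto simp: W_def S_def)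
    then show ?thesis using Pk(3)[OF that] by blast
  qed
  note WV = this
  have q': "biclique_packing E a (W k) (q k)" "W k \<subseteq> V" if "k \<in> {..<K}" for k
    using q WV that by simp_all
  have Q: "biclique_packing E a V (\<Union>k<K. q k)" "card (\<Union>k<K. q k) = (\<Sum>k<K. card (q k))"
    by (rule biclique_packing_Union[OF finite_lessThan q'(1) W_disj q'(2) a]; assumption)+
  have w: "(\<Sum>p\<in>#P. card (fst p)) = (\<Sum>k<K. card (fst (ps ! k)))"
  proof -
    have "(\<Sum>p\<in>#P. card (fst p)) = sum_list (map (\<lambda>p. card (fst p)) ps)"
      unfolding ps[symmetric] by (metis mset_map sum_mset_sum_list)
    then show ?thesis by (simp add: K_def sum_list_sum_nth atLeast0LessThan)
  qed
  have "s * (\<Sum>k<K. card (fst (ps ! k)))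
      \<le> (\<Sum>k<K. s * N * a * card (q k) + card (fst (ps ! k)) + s * N * 4 ^ K)"
    unfolding sum_distrib_left using qc by (intro sum_mono) auto
  also have "\<dots> = s * N * a * card (\<Union>k<K. q k) + (\<Sum>k<K. card (fst (ps ! k))) + s * N * K * 4 ^ K"
    by (simp add: sum.distrib sum_distrib_left Q(2))
  finally show thesis using that[OF Q(1)] by (simp add: w)
qed

text \<open>The duality statement for packings of bicliques. Since all pairs have size at least \<open>m\<close>,
at most \<open>(s\<^sup>2 + s) * L\<close> of them occur in the optimal family, so the additive error of the rounding is
bounded by a constant and becomes negligible against \<open>card V / s\<close>.\<close>

lemma half_integral_cover:
  fixes V :: "'v set"
  assumes fin: "finite V" and a: "a \<ge> 1" and s: "s \<ge> 1" and m: "m \<ge> 1"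
    and nm: "card V \<le> L * m"
    and big: "s * (((s\<^sup>2 + s) * L) * 4 ^ ((s\<^sup>2 + s) * L)) \<le> card V"
  obtains Q and Z :: "'v \<Rightarrow> nat" where "biclique_packing E a V Q" and "\<And>v. Z v \<le> 2"
    and "\<And>X Y. X \<union> Y \<subseteq> V \<Longrightarrow> X \<inter> Y = {} \<Longrightarrow> card X = card Y \<Longrightarrow> m \<le> card X \<Longrightarrow>
            dense_pair E a (s * (s\<^sup>2 + s)) X Y \<Longrightarrow> \<exists>u\<in>X. \<exists>v\<in>Y. 2 \<le> Z u + Z v"
    and "s * (\<Sum>v\<in>V. Z v) \<le> 2 * s * a * card Q + 6 * card V"
proof -
  define N where "N = s\<^sup>2 + s"
  define n where "n = card V"
  have N: "N \<ge> 1" using s by (simp add: N_def)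
  define D where "D = {(X, Y). X \<union> Y \<subseteq> V \<and> X \<inter> Y = {} \<and> card X = card Y \<and> m \<le> card X
      \<and> dense_pair E a (s * N) X Y}"
  have "X \<inter> Y = {} \<and> card X = card Y \<and> X \<noteq> {} \<and> X \<union> Y \<subseteq> V" if "(X, Y) \<in> D" for X Y
    using that m by (auto simp: D_def)
  from optimal_load[OF fin s this] obtain P where P: "set_mset P \<subseteq> D" and loadN: "\<And>v. load P v \<le> N"
    and cover: "\<And>X Y. (X, Y) \<in> D \<Longrightarrow> \<exists>u\<in>X. \<exists>v\<in>Y. s \<le> (load P u - s\<^sup>2) + (load P v - s\<^sup>2)"
    and cost: "s * (\<Sum>v\<in>V. load P v - s\<^sup>2) \<le> s * n + (\<Sum>p\<in>#P. card (fst p))"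
    unfolding N_def n_def by blast
  define w where "w = (\<Sum>p\<in>#P. card (fst p))"
  define Yt where "Yt = (\<Sum>v\<in>V. load P v - s\<^sup>2)"
  have PD: "p \<in> D" if "p \<in># P" for p using P that by auto
  have w2: "2 * w \<le> N * n"
  proof -
    have "2 * w = (\<Sum>p\<in>#P. 2 * card (fst p))" by (simp add: w_def sum_mset_distrib_left)
    also have "\<dots> = (\<Sum>p\<in>#P. \<Sum>v\<in>verts p. 1)"
    proof (rule arg_cong[of _ _ sum_mset], rule image_mset_cong)
      fix p assume "p \<in># P"
      then have "fst p \<inter> snd p = {}" "card (fst p) = card (snd p)" "finite (fst p)" "finite (snd p)"
        using PD[of p] fin finite_subset by (auto simp: D_def)
      then show "2 * card (fst p) = (\<Sum>v\<in>verts p. 1)" by (simp add: card_Un_disjoint)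
    qed
    also have "\<dots> = (\<Sum>v\<in>V. load P v * 1)"
      using PD fin by (intro sum_load) (fastforce simp: D_def)+
    also have "\<dots> \<le> (\<Sum>v\<in>V. N)" using loadN by (intro sum_mono) simp
    finally show ?thesis by (simp add: n_def mult.commute)
  qed
  have "m * size P \<le> w"
  proof -
    have "m * size P = (\<Sum>p\<in>#P. m)" by (simp add: mult.commute)
    also have "\<dots> \<le> w" unfolding w_def using PD by (intro sum_mset_mono) (fastforce simp: D_def)
    finally show ?thesis .
  qed
  also have "w \<le> N * n" using w2 by simp
  also have "\<dots> \<le> N * (L * m)" using nm by (simp add: n_def)
  finally have "m * size P \<le> m * (N * L)" by (simp add: algebra_simps)
  then have K: "size P \<le> N * L" using m by simp
  have "X \<inter> Y = {} \<and> card X = card Y \<and> X \<union> Y \<subseteq> V \<and> dense_pair E a (s * N) X Y"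
    if "(X, Y) \<in># P" for X Y using PD[OF that] by (auto simp: D_def)
  from round_fractional_packing[OF fin a N s this loadN] obtain Q where Q: "biclique_packing E a V Q"
    and Qc: "s * w \<le> s * N * a * card Q + w + s * N * size P * 4 ^ size P"
    unfolding w_def by blast
  have "size P * 4 ^ size P \<le> (N * L) * 4 ^ (N * L)"
    using K by (intro mult_le_mono power_increasing) auto
  then have "s * (size P * 4 ^ size P) \<le> n"
    using mult_le_mono2[of _ _ s] big le_trans unfolding N_def n_def by blast
  then have "N * (s * (size P * 4 ^ size P)) \<le> N * n" by simp
  moreover have "s * N * size P * 4 ^ size P = N * (s * (size P * 4 ^ size P))" by simp
  ultimately have "2 * (s * w) \<le> 2 * (s * N * a * card Q) + 2 * w + 2 * (N * n)"
    using Qc by linarith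
  then have sw: "2 * (s * w) \<le> 2 * (s * N * a * card Q) + 3 * (N * n)" using w2 by linarith
  have Yt: "s * Yt \<le> s * n + w" using cost by (simp add: Yt_def w_def)
  have "load P v - s\<^sup>2 \<le> s" for v using loadN[of v] by (simp add: N_def)
  from half_integral_rounding[where Y = "\<lambda>v. load P v - s\<^sup>2" and V = V, OF s this] obtain Z :: "'v \<Rightarrow> nat" where Z: "\<And>v. Z v \<le> 2"
    and Zs: "s * (\<Sum>v\<in>V. Z v) \<le> 2 * Yt"
    and Zc: "\<And>u v. s \<le> (load P u - s\<^sup>2) + (load P v - s\<^sup>2) \<Longrightarrow> 2 \<le> Z u + Z v"
    unfolding Yt_def by blast
  have "Yt \<le> s * a * card Q + 3 * n"
  proof -
    have "N * (s * Yt) \<le> N * (s * n + w)" using Yt by (rule mult_le_mono2)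
    moreover have "N * (s * n + w) = s * N * n + s * (s * w) + s * w"
      by (simp add: N_def power2_eq_square algebra_simps)
    ultimately have "N * (s * Yt) \<le> s * N * n + s * (s * w) + s * w" by (simp only:)
    then have "2 * (N * (s * Yt)) \<le> 2 * (s * N * n + s * (s * w) + s * w)" by (rule mult_le_mono2)
    also have "\<dots> = 2 * (s * N * n) + s * (2 * (s * w)) + s * (2 * w)" by (simp add: algebra_simps)
    also have "\<dots> \<le> 2 * (s * N * n) + s * (2 * (s * N * a * card Q) + 3 * (N * n)) + s * (N * n)"
      by (intro add_mono mult_le_mono2 order_refl sw w2)
    also have "\<dots> = 2 * (N * (s * (s * a * card Q + 3 * n)))" by (simp add: algebra_simps)
    finally show ?thesis using N s by simp
  qed
  then have "s * (\<Sum>v\<in>V. Z v) \<le> 2 * s * a * card Q + 6 * n" using Zs by linarith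
  moreover have "\<exists>u\<in>X. \<exists>v\<in>Y. 2 \<le> Z u + Z v"
    if "X \<union> Y \<subseteq> V" "X \<inter> Y = {}" "card X = card Y" "m \<le> card X" "dense_pair E a (s * (s\<^sup>2 + s)) X Y" for X Y
  proof -
    have "(X, Y) \<in> D" using that by (simp add: D_def N_def)
    from cover[OF this] show ?thesis using Zc by blast
  qed
  ultimately show thesis using that Q Z unfolding n_def by blast
qed

section \<open>Combining the colours\<close>

lemma large_fibre:
  assumes "finite Y" "finite B" "B \<noteq> {}" "g ` Y \<subseteq> B" "a * card B \<le> card Y"
  shows "\<exists>b\<in>B. a \<le> card {v\<in>Y. g v = b}"
proof (rule ccontr)
  assume "\<not> ?thesis"
  then have "(\<Sum>b\<in>B. card {v\<in>Y. g v = b}) < (\<Sum>b\<in>B. a)"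
    using assms(2,3) by (intro sum_strict_mono) auto
  moreover have "(\<Sum>b\<in>B. card {v\<in>Y. g v = b}) = card Y"
    using sum.group[OF assms(1,2,4), of "\<lambda>_. 1::nat"] by simp
  ultimately show False using assms(5) by (simp add: mult.commute)
qed

text \<open>Fix \<open>r * a\<close> vertices of \<open>X\<close>. The vertices of \<open>Y\<close> see them in at most \<open>r ^ (r * a)\<close> colour patterns, so \<open>a\<close> of
them see the same one, and some colour occurs \<open>a\<close> times in it.\<close>

lemma bipartite_ramsey:
  fixes c :: "'v \<Rightarrow> 'v \<Rightarrow> nat"
  assumes "finite X" "finite Y" "r \<ge> 1" and big: "r * a \<le> card X" "a * r ^ (r * a) \<le> card Y"
    and c: "\<And>u v. u \<in> X \<Longrightarrow> v \<in> Y \<Longrightarrow> c u v \<in> {1..r}"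
  shows "\<exists>l\<in>{1..r}. has_biclique (\<lambda>u v. c u v = l) a X Y"
proof -
  obtain X0 where X0: "X0 \<subseteq> X" "card X0 = r * a" using obtain_subset_with_card_n[OF big(1)] by blast
  have fX0: "finite X0" using X0 assms(1) finite_subset by blast
  define pat where "pat v = restrict (\<lambda>u. c u v) X0" for v
  let ?B = "X0 \<rightarrow>\<^sub>E {1..r}"
  have cB: "card ?B = r ^ (r * a)" using fX0 X0 by (simp add: card_PiE)
  have "pat ` Y \<subseteq> ?B" using c X0 by (auto simp: pat_def)
  moreover have "finite ?B" using fX0 by (intro finite_PiE) auto
  moreover have "?B \<noteq> {}" using assms(3) by (auto simp: PiE_eq_empty_iff)
  ultimately obtain \<phi> where \<phi>: "\<phi> \<in> ?B" "a \<le> card {v\<in>Y. pat v = \<phi>}"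
    using large_fibre[OF assms(2), of ?B pat a] big(2) cB by auto
  obtain T where T: "T \<subseteq> {v\<in>Y. pat v = \<phi>}" "card T = a"
    using obtain_subset_with_card_n[OF \<phi>(2)] by blast
  have "\<phi> ` X0 \<subseteq> {1..r}" using \<phi>(1) by (auto simp: PiE_def Pi_def)
  then obtain l where l: "l \<in> {1..r}" "a \<le> card {u\<in>X0. \<phi> u = l}"
    using large_fibre[OF fX0, of "{1..r}" \<phi> a] assms(3) X0 by (auto simp: mult.commute)
  obtain S where S: "S \<subseteq> {u\<in>X0. \<phi> u = l}" "card S = a"
    using obtain_subset_with_card_n[OF l(2)] by blast
  have "c u v = l" if "u \<in> S" "v \<in> T" for u v
  proof -
    have "u \<in> X0" "\<phi> u = l" "pat v = \<phi>" using that S T by auto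
    then show ?thesis by (auto simp: pat_def)
  qed
  then have "biclique (\<lambda>u v. c u v = l) a S T" using S T by (simp add: biclique_def)
  moreover have "S \<subseteq> X" "T \<subseteq> Y" using S T X0 by auto
  ultimately show ?thesis using l(1) unfolding has_biclique_def by blast
qed

lemma has_biclique_mono: "has_biclique E a X' Y' \<Longrightarrow> X' \<subseteq> X \<Longrightarrow> Y' \<subseteq> Y \<Longrightarrow> has_biclique E a X Y"
  unfolding has_biclique_def by blast

text \<open>Each colour that is not dense can be eliminated by passing to subsets, at the cost of a factor \<open>N\<close> in
the sizes. Colours eliminated earlier stay eliminated, because having no biclique is inherited by subsets.\<close>

lemma biclique_free_subpair:
  assumes "finite C" and N: "N \<ge> 1" and "finite X" "finite Y"
    and "card X = card Y" "m * N ^ card C \<le> card X"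
    and "\<And>l X' Y'. l \<in> C \<Longrightarrow> X' \<subseteq> X \<Longrightarrow> Y' \<subseteq> Y \<Longrightarrow> card X' = card Y' \<Longrightarrow> m \<le> card X' \<Longrightarrow>
            \<not> dense_pair (E l) a N X' Y'"
  shows "\<exists>X'\<subseteq>X. \<exists>Y'\<subseteq>Y. card X' = card Y' \<and> m \<le> card X' \<and> (\<forall>l\<in>C. \<not> has_biclique (E l) a X' Y')"
  using assms(1,3-)
proof (induction C arbitrary: X Y)
  case empty
  then show ?case by (intro exI[of _ X] exI[of _ Y]) auto
next
  case (insert l C)
  let ?k = "m * N ^ card C"
  have N_k: "N * ?k \<le> card X" using insert by (simp add: algebra_simps)
  have mk: "m \<le> ?k" using N by simp
  also have "?k \<le> N * ?k" using N by simp
  also note N_k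
  finally have "\<not> dense_pair (E l) a N X Y" using insert.prems by auto
  then obtain X1 Y1 where 1: "X1 \<subseteq> X" "Y1 \<subseteq> Y" "card X \<le> N * card X1" "card Y \<le> N * card Y1"
    and free: "\<not> has_biclique (E l) a X1 Y1" unfolding dense_pair_def by blast
  have "N * ?k \<le> N * card X1" "N * ?k \<le> N * card Y1"
    using N_k 1 insert.prems(3) by linarith+
  then have k: "?k \<le> card X1" "?k \<le> card Y1" using N by simp_all
  obtain X2 where X2: "X2 \<subseteq> X1" "card X2 = ?k" using obtain_subset_with_card_n[OF k(1)] by blast
  obtain Y2 where Y2: "Y2 \<subseteq> Y1" "card Y2 = ?k" using obtain_subset_with_card_n[OF k(2)] by blast
  note 2 = X2 Y2
  have "\<exists>X'\<subseteq>X2. \<exists>Y'\<subseteq>Y2. card X' = card Y' \<and> m \<le> card X' \<and> (\<forall>l\<in>C. \<not> has_biclique (E l) a X' Y')"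
  proof (rule insert.IH)
    have "X2 \<subseteq> X" "Y2 \<subseteq> Y" using 1 2 by auto
    then show "finite X2" "finite Y2" using insert.prems(1,2) by (simp_all add: finite_subset)
    show "card X2 = card Y2" "?k \<le> card X2" using 2 by auto
    show "\<not> dense_pair (E l') a N X' Y'" if "l' \<in> C" "X' \<subseteq> X2" "Y' \<subseteq> Y2" "card X' = card Y'" "m \<le> card X'"
      for l' X' Y'
    proof -
      have "X' \<subseteq> X" "Y' \<subseteq> Y" using that(2,3) 1(1,2) 2(1,3) by blast+
      then show ?thesis using insert.prems(5)[of l' X' Y'] that(1,4,5) by simp
    qed
  qed
  then obtain X' Y' where 3: "X' \<subseteq> X2" "Y' \<subseteq> Y2" "card X' = card Y'" "m \<le> card X'"
    "\<forall>l\<in>C. \<not> has_biclique (E l) a X' Y'" by blast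
  have "\<not> has_biclique (E l) a X' Y'" using free has_biclique_mono[of "E l" a X' Y' X1 Y1] 3(1,2) 2(1,3) by blast
  then have "\<forall>l\<in>insert l C. \<not> has_biclique (E l) a X' Y'" using 3(5) by simp
  moreover have "X' \<subseteq> X" "Y' \<subseteq> Y" using 1(1,2) 2(1,3) 3(1,2) by auto
  ultimately show ?case using 3(3,4) by blast
qed

text \<open>Let \<open>W\<close> be the set of vertices with no weight 2; the others have total weight at least 2 over
the colours. If some colour \<open>l\<close> is 1 on all of \<open>W\<close>, then counting \<open>Z l\<close> twice gives every vertex at least 2. Otherwise
every \<open>v \<in> W\<close> already has total weight 2: the pair \<open>(v, v)\<close> gives a colour \<open>l\<close> with \<open>Z l v = 1\<close>, and pairing \<open>v\<close> with some
\<open>w \<in> W\<close> with \<open>Z l w = 0\<close> gives a second one.\<close>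

lemma half_integral_covers_bound:
  fixes Z :: "'c \<Rightarrow> 'v \<Rightarrow> nat"
  assumes fin: "finite V" "finite R"
    and cov: "\<And>u v. u \<in> V \<Longrightarrow> v \<in> V \<Longrightarrow> \<exists>l\<in>R. 2 \<le> Z l u + Z l v"
    and B: "\<And>l. l \<in> R \<Longrightarrow> (\<Sum>v\<in>V. Z l v) \<le> B"
  shows "2 * card V \<le> (card R + 1) * B"
proof -
  define W where "W = {v\<in>V. \<forall>l\<in>R. Z l v \<le> 1}"
  have total: "(\<Sum>v\<in>V. \<Sum>l\<in>R. Z l v) \<le> card R * B"
    using sum_bounded_above[of R "\<lambda>l. \<Sum>v\<in>V. Z l v" B] B by (subst sum.swap) simp
  have heavy: "2 \<le> (\<Sum>l\<in>R. Z l v)" if v: "v \<in> V" "v \<notin> W" for v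
  proof -
    obtain l where "l \<in> R" "2 \<le> Z l v" using v by (auto simp: W_def)
    then show ?thesis using member_le_sum[of l R "\<lambda>l. Z l v"] fin by force
  qed
  show ?thesis
  proof (cases "\<exists>l\<in>R. \<forall>v\<in>W. Z l v = 1")
    case True
    then obtain l where l: "l \<in> R" "\<forall>v\<in>W. Z l v = 1" by blast
    have "2 \<le> Z l v + (\<Sum>l\<in>R. Z l v)" if "v \<in> V" for v
    proof (cases "v \<in> W")
      case True
      then have "Z l v = 1" using l(2) by blast
      then show ?thesis using member_le_sum[of l R "\<lambda>l. Z l v"] fin l(1) by force
    next
      case False
      then show ?thesis using heavy[OF that] by linarith
    qed
    then have "(\<Sum>v\<in>V. 2) \<le> (\<Sum>v\<in>V. Z l v + (\<Sum>l\<in>R. Z l v))" by (rule sum_mono)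
    then show ?thesis using B[OF l(1)] total by (simp add: sum.distrib algebra_simps)
  next
    case False
    have "2 \<le> (\<Sum>l\<in>R. Z l v)" if v: "v \<in> V" for v
    proof (cases "v \<in> W")
      case True
      obtain l where l: "l \<in> R" "2 \<le> Z l v + Z l v" using cov[OF v v] by blast
      obtain w where w: "w \<in> W" "Z l w \<noteq> 1" using \<open>\<not> (\<exists>l\<in>R. \<forall>v\<in>W. Z l v = 1)\<close> l(1) by blast
      have "w \<in> V" using w by (simp add: W_def)
      then obtain l' where l': "l' \<in> R" "2 \<le> Z l' v + Z l' w" using cov[OF v] by blast
      have le: "Z l' v \<le> 1" "Z l' w \<le> 1" using True w l' by (auto simp: W_def)
      then have "Z l' w = 1" using l' by linarith
      then have "l \<noteq> l'" using w by blast
      have "(\<Sum>l\<in>{l, l'}. Z l v) \<le> (\<Sum>l\<in>R. Z l v)" using fin l l' by (intro sum_mono2) auto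
      moreover have "1 \<le> Z l v" "1 \<le> Z l' v" using l l' le by linarith+
      ultimately show ?thesis using \<open>l \<noteq> l'\<close> by simp
    qed (use heavy v in blast)
    then have "(\<Sum>v\<in>V. 2) \<le> (\<Sum>v\<in>V. \<Sum>l\<in>R. Z l v)" by (rule sum_mono)
    then show ?thesis using total by simp
  qed
qed

text \<open>In terms of \<open>n = card V\<close>, this is \<open>k \<ge> (1 / (a * (r + 1)) - O(1 / s)) * n\<close> for all large \<open>n\<close>. The minimum size
\<open>m\<close> of the dense pairs is chosen so small that two sets of size \<open>m * N ^ r\<close>, which survive \<open>r\<close> passages to
subsets, fit into every class of vertices apart from classes that contain at most \<open>n / s\<close> vertices together.\<close>

lemma monochromatic_packing_bound:
  assumes a: "a \<ge> 1" and r: "r \<ge> 1" and s: "s \<ge> 1"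
  shows "\<exists>n0. \<forall>(V :: 'v set) c k. finite V \<longrightarrow> n0 \<le> card V \<longrightarrow>
      (\<forall>u\<in>V. \<forall>v\<in>V. u \<noteq> v \<longrightarrow> c u v \<in> {1..r}) \<longrightarrow>
      (\<forall>l\<in>{1..r}. \<forall>Q. biclique_packing (\<lambda>u v. c u v = l) a V Q \<longrightarrow> card Q \<le> k) \<longrightarrow>
      2 * s * card V \<le> (r + 1) * (2 * s * a * k + 6 * card V) + 2 * card V"
proof -
  define N where "N = s * (s\<^sup>2 + s)"
  define D where "D = 2 * s * 3 ^ r * N ^ r"
  define R0 where "R0 = r * a + a * r ^ (r * a)"
  \<comment> \<open>enough for \<open>bipartite_ramsey\<close> on sets of size \<open>m\<close>, and for \<open>half_integral_cover\<close> with \<open>L = 2 * D\<close>\<close>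
  define n0 where "n0 = D * R0 + s * (((s\<^sup>2 + s) * (2 * D)) * 4 ^ ((s\<^sup>2 + s) * (2 * D)))"
  have N: "N \<ge> 1" using s by (simp add: N_def)
  have D: "D \<ge> 1" using s N by (simp add: D_def)
  have R0: "R0 \<ge> 1" using mult_le_mono[OF r a] unfolding R0_def by linarith
  have "2 * s * card V \<le> (r + 1) * (2 * s * a * k + 6 * card V) + 2 * card V"
    if fin: "finite V" and n: "n0 \<le> card V"
      and c: "\<And>u v. u \<in> V \<Longrightarrow> v \<in> V \<Longrightarrow> u \<noteq> v \<Longrightarrow> c u v \<in> {1..r}"
      and k: "\<And>l Q. l \<in> {1..r} \<Longrightarrow> biclique_packing (\<lambda>u v. c u v = l) a V Q \<Longrightarrow> card Q \<le> k"
    for V :: "'v set" and c :: "'v \<Rightarrow> 'v \<Rightarrow> nat" and k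
  proof -
    define E where "E l = (\<lambda>u v. c u v = l)" for l
    define m where "m = card V div D"
    have "D * R0 \<le> card V" using n by (simp add: n0_def)
    then have mR: "R0 \<le> m" using D by (simp add: m_def less_eq_div_iff_mult_less_eq mult.commute)
    then have m: "m \<ge> 1" using R0 by simp
    have Dm: "D * m \<le> card V" by (simp add: m_def)
    have "card V < D * m + D" using D mod_less_divisor[of D "card V"] mult_div_mod_eq[of D "card V"]
      unfolding m_def by linarith
    then have nL: "card V \<le> (2 * D) * m"
      using mult_le_mono2[OF m, of D] unfolding mult.assoc by linarith
    have big: "s * (((s\<^sup>2 + s) * (2 * D)) * 4 ^ ((s\<^sup>2 + s) * (2 * D))) \<le> card V"
      using n by (simp add: n0_def)
    define good :: "nat \<Rightarrow> ('v \<Rightarrow> nat) \<Rightarrow> bool" where "good l Z \<longleftrightarrow> (\<forall>v. Z v \<le> 2) \<and>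
        (\<forall>X Y. X \<union> Y \<subseteq> V \<longrightarrow> X \<inter> Y = {} \<longrightarrow> card X = card Y \<longrightarrow> m \<le> card X \<longrightarrow>
            dense_pair (E l) a N X Y \<longrightarrow> (\<exists>u\<in>X. \<exists>v\<in>Y. 2 \<le> Z u + Z v)) \<and>
        s * (\<Sum>v\<in>V. Z v) \<le> 2 * s * a * k + 6 * card V" for l Z
    have "\<exists>Z. good l Z" if l: "l \<in> {1..r}" for l
    proof -
      obtain Q and Z :: "'v \<Rightarrow> nat" where Q: "biclique_packing (E l) a V Q"
        and Z: "\<And>v. Z v \<le> 2"
        and cov: "\<And>X Y. X \<union> Y \<subseteq> V \<Longrightarrow> X \<inter> Y = {} \<Longrightarrow> card X = card Y \<Longrightarrow> m \<le> card X \<Longrightarrow>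
            dense_pair (E l) a (s * (s\<^sup>2 + s)) X Y \<Longrightarrow> \<exists>u\<in>X. \<exists>v\<in>Y. 2 \<le> Z u + Z v"
        and Zs: "s * (\<Sum>v\<in>V. Z v) \<le> 2 * s * a * card Q + 6 * card V"
        by (rule half_integral_cover[OF fin a s m nL big, of "E l"]) blast
      have "card Q \<le> k" using k[OF l] Q by (simp add: E_def)
      then have "2 * s * a * card Q \<le> 2 * s * a * k" by simp
      then have "s * (\<Sum>v\<in>V. Z v) \<le> 2 * s * a * k + 6 * card V" using Zs by linarith
      then show ?thesis using Z cov unfolding good_def N_def by (intro exI[of _ Z]) simp
    qed
    then have "\<forall>l. \<exists>Z. l \<in> {1..r} \<longrightarrow> good l Z" by blast
    from choice[OF this] obtain Z where good: "\<And>l. l \<in> {1..r} \<Longrightarrow> good l (Z l)" by blast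
    have Z: "Z l v \<le> 2"
      and cov: "\<And>X Y. X \<union> Y \<subseteq> V \<Longrightarrow> X \<inter> Y = {} \<Longrightarrow> card X = card Y \<Longrightarrow> m \<le> card X \<Longrightarrow>
            dense_pair (E l) a N X Y \<Longrightarrow> \<exists>u\<in>X. \<exists>v\<in>Y. 2 \<le> Z l u + Z l v"
      and Zs: "s * (\<Sum>v\<in>V. Z l v) \<le> 2 * s * a * k + 6 * card V"
      if "l \<in> {1..r}" for l v
      using good[OF that] by (simp_all add: good_def)
    \<comment> \<open>the class of a vertex; classes smaller than \<open>thr\<close> are discarded\<close>
    define \<tau> where "\<tau> v = restrict (\<lambda>l. Z l v) {1..r}" for v
    let ?T = "{1..r} \<rightarrow>\<^sub>E {0..2::nat}"
    have cT: "card ?T = 3 ^ r" by (simp add: card_PiE)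
    have fT: "finite ?T" by (intro finite_PiE) auto
    have \<tau>T: "\<tau> v \<in> ?T" for v using Z by (auto simp: \<tau>_def)
    define thr where "thr = 2 * (m * N ^ r)"
    define V' where "V' = {v\<in>V. thr \<le> card {u\<in>V. \<tau> u = \<tau> v}}"
    define B where "B = Max ((\<lambda>l. \<Sum>v\<in>V'. Z l v) ` {1..r})"
    have V'V: "V' \<subseteq> V" by (auto simp: V'_def)
    have fV': "finite V'" using V'V fin finite_subset by blast
    have pairs: "\<exists>l\<in>{1..r}. 2 \<le> Z l u + Z l v" if u: "u \<in> V'" and v: "v \<in> V'" for u v
    proof (rule ccontr)
      assume neg: "\<not> ?thesis"
      \<comment> \<open>\<open>u\<close> and \<open>v\<close> may be in the same class, hence the factor 2 in \<open>thr\<close>\<close>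
      have "m * N ^ r \<le> card {x\<in>V. \<tau> x = \<tau> u}" using u by (simp add: V'_def thr_def)
      from obtain_subset_with_card_n[OF this]
      obtain X where X: "X \<subseteq> {x\<in>V. \<tau> x = \<tau> u}" "card X = m * N ^ r" by blast
      have fX: "finite X" using X(1) fin finite_subset[of X V] by blast
      have "m * N ^ r \<le> card ({x\<in>V. \<tau> x = \<tau> v} - X)"
      proof -
        have "2 * (m * N ^ r) \<le> card {x\<in>V. \<tau> x = \<tau> v}" using v by (simp add: V'_def thr_def)
        then show ?thesis
          using diff_card_le_card_Diff[OF fX, of "{x\<in>V. \<tau> x = \<tau> v}"] X(2) by linarith
      qed
      from obtain_subset_with_card_n[OF this]
      obtain Y where Y: "Y \<subseteq> {x\<in>V. \<tau> x = \<tau> v} - X" "card Y = m * N ^ r" by blast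
      have fY: "finite Y" using Y(1) fin finite_subset[of Y V] by blast
      have low: "\<not> dense_pair (E l) a N X' Y'"
        if l: "l \<in> {1..r}" and XY: "X' \<subseteq> X" "Y' \<subseteq> Y" "card X' = card Y'" "m \<le> card X'" for l X' Y'
      proof
        assume d: "dense_pair (E l) a N X' Y'"
        have "X' \<union> Y' \<subseteq> V" "X' \<inter> Y' = {}" using XY X Y by auto
        from cov[OF l this XY(3,4) d] obtain x y where xy: "x \<in> X'" "y \<in> Y'" "2 \<le> Z l x + Z l y" by blast
        have "\<tau> x = \<tau> u" "\<tau> y = \<tau> v" using xy XY X Y by auto
        then have "\<tau> x l = \<tau> u l" "\<tau> y l = \<tau> v l" by simp_all
        then have "Z l x = Z l u" "Z l y = Z l v" using l by (simp_all add: \<tau>_def)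
        then show False using neg l xy(3) by auto
      qed
      have "\<exists>X'\<subseteq>X. \<exists>Y'\<subseteq>Y. card X' = card Y' \<and> m \<le> card X' \<and> (\<forall>l\<in>{1..r}. \<not> has_biclique (E l) a X' Y')"
        using X(2) Y(2) by (intro biclique_free_subpair[OF _ N fX fY] low) auto
      then obtain X' Y' where X'Y': "X' \<subseteq> X" "Y' \<subseteq> Y" "card X' = card Y'" "m \<le> card X'"
        and free: "\<And>l. l \<in> {1..r} \<Longrightarrow> \<not> has_biclique (E l) a X' Y'" by blast
      have "\<exists>l\<in>{1..r}. has_biclique (\<lambda>u v. c u v = l) a X' Y'"
      proof (rule bipartite_ramsey[OF _ _ r])
        show "finite X'" "finite Y'" using X'Y'(1,2) fX fY by (simp_all add: finite_subset)
        show "r * a \<le> card X'" "a * r ^ (r * a) \<le> card Y'" using X'Y'(3,4) mR by (simp_all add: R0_def)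
        show "c x y \<in> {1..r}" if "x \<in> X'" "y \<in> Y'" for x y
          using that X'Y'(1,2) X Y by (intro c) auto
      qed
      then show False using free by (auto simp: E_def)
    qed
    have "2 * card V' \<le> (card {1..r} + 1) * B"
    proof (rule half_integral_covers_bound[OF fV' _ pairs])
      show "(\<Sum>v\<in>V'. Z l v) \<le> B" if "l \<in> {1..r}" for l using that by (simp add: B_def)
    qed auto
    moreover have "s * B \<le> 2 * s * a * k + 6 * card V"
    proof -
      have "B \<in> (\<lambda>l. \<Sum>v\<in>V'. Z l v) ` {1..r}" unfolding B_def using r by (intro Max_in) auto
      then obtain l where l: "l \<in> {1..r}" "B = (\<Sum>v\<in>V'. Z l v)" by blast
      have "B \<le> (\<Sum>v\<in>V. Z l v)" unfolding l(2) using fin V'V by (intro sum_mono2) auto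
      then have "s * B \<le> s * (\<Sum>v\<in>V. Z l v)" by (rule mult_le_mono2)
      then show ?thesis using Zs[OF l(1)] by (rule le_trans)
    qed
    moreover have "s * card V \<le> s * card V' + card V"
    proof -
      have "V - V' \<subseteq> (\<Union>t\<in>{t\<in>?T. card {u\<in>V. \<tau> u = t} \<le> thr}. {u\<in>V. \<tau> u = t})"
        using \<tau>T by (auto simp: V'_def)
      then have "card (V - V') \<le> card (\<Union>t\<in>{t\<in>?T. card {u\<in>V. \<tau> u = t} \<le> thr}. {u\<in>V. \<tau> u = t})"
        using fin fT by (intro card_mono) auto
      also have "\<dots> \<le> (\<Sum>t\<in>{t\<in>?T. card {u\<in>V. \<tau> u = t} \<le> thr}. card {u\<in>V. \<tau> u = t})"
        using fT by (intro card_UN_le) auto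
      also have "\<dots> \<le> card {t\<in>?T. card {u\<in>V. \<tau> u = t} \<le> thr} * thr"
        using sum_bounded_above[of "{t\<in>?T. card {u\<in>V. \<tau> u = t} \<le> thr}" "\<lambda>t. card {u\<in>V. \<tau> u = t}" thr] by simp
      also have "\<dots> \<le> 3 ^ r * thr"
        unfolding cT[symmetric] using fT by (intro mult_le_mono1 card_mono) auto
      finally have "s * card (V - V') \<le> s * (3 ^ r * thr)" by simp
      also have "\<dots> = D * m" by (simp add: D_def thr_def algebra_simps)
      finally have "s * card (V - V') \<le> card V" using Dm by linarith
      moreover have "card V = card V' + card (V - V')"
        using V'V fin fV' by (simp add: card_Diff_subset card_mono)
      ultimately show ?thesis by (metis add_le_cancel_left distrib_left)
    qed
    ultimately have "2 * card V' \<le> (r + 1) * B" "s * B \<le> 2 * s * a * k + 6 * card V"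
      "s * card V \<le> s * card V' + card V" by auto
    note 1 = this
    have "s * (2 * card V') \<le> s * ((r + 1) * B)" using 1(1) by (rule mult_le_mono2)
    also have "\<dots> = (r + 1) * (s * B)" by (simp add: algebra_simps)
    also have "\<dots> \<le> (r + 1) * (2 * s * a * k + 6 * card V)" using 1(2) by (rule mult_le_mono2)
    finally show ?thesis using 1(3) by simp
  qed
  then show ?thesis by (intro exI[of _ n0]) blast
qed

section \<open>Packings of copies of a bipartite graph\<close>

lemma packing_number_ge:
  assumes "simple_graph G" "disjoint_copies H G P"
  shows "card P \<le> packing_number H G"
  unfolding packing_number_def
  using finite_packing_sizes(1)[OF assms(1), of H] assms(2) by (intro Max_ge) auto

lemma packing_number_witness:
  fixes H :: "'v ugraph" and G :: "'w ugraph"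
  assumes "simple_graph G"
  obtains P where "disjoint_copies H G P" "card P = packing_number H G"
proof -
  have "packing_number H G \<in> {card P | P. disjoint_copies H G P}"
    unfolding packing_number_def by (intro Max_in finite_packing_sizes[OF assms])
  then show thesis using that by auto
qed

text \<open>The two sides of a biclique can be labelled by \<open>A\<close> and \<open>B\<close> in any way, as all pairs across it are edges.\<close>

lemma biclique_packing_le_packing_number:
  fixes H :: "'v ugraph" and E :: "'w \<Rightarrow> 'w \<Rightarrow> bool"
  assumes a: "a \<ge> 1" and bip: "bipartition H A B" "card A = a" "card B = a"
    and G: "simple_graph G"
    and E: "\<And>u v. u \<in> vertices G \<Longrightarrow> v \<in> vertices G \<Longrightarrow> u \<noteq> v \<Longrightarrow> E u v \<Longrightarrow> {u, v} \<in> edges G"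
    and Q: "biclique_packing E a (vertices G) Q"
  shows "card Q \<le> packing_number H G"
proof -
  have AB: "A \<union> B = vertices H" "A \<inter> B = {}" and He: "\<And>e. e \<in> edges H \<Longrightarrow> \<exists>x\<in>A. \<exists>y\<in>B. e = {x, y}"
    using bip(1) by (auto simp: bipartition_def)
  have fin: "finite A" "finite B" using a bip by (auto intro: card_ge_0_finite)
  have Qp: "biclique E a (fst p) (snd p)" "fst p \<inter> snd p = {}" "verts p \<subseteq> vertices G" if "p \<in> Q" for p
    using Q that by (auto simp: biclique_packing_def split_beta)
  have copy: "\<exists>C. is_copy H G C \<and> vertices C = verts p" if p: "p \<in> Q" for p
  proof -
    have c: "card (fst p) = a" "card (snd p) = a" using Qp(1)[OF p] by (auto simp: biclique_def)
    then have "finite (fst p)" "finite (snd p)" using a by (auto intro: card_ge_0_finite)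
    then obtain g h where g: "bij_betw g A (fst p)" and h: "bij_betw h B (snd p)"
      using finite_same_card_bij[of A "fst p"] finite_same_card_bij[of B "snd p"] fin c bip by auto
    define f where "f x = (if x \<in> A then g x else h x)" for x
    have gA: "g ` A = fst p" and hB: "h ` B = snd p" using g h by (auto simp: bij_betw_def)
    have fA: "f ` A = fst p" unfolding gA[symmetric] by (rule image_cong) (simp_all add: f_def)
    have fB: "f ` B = snd p" unfolding hB[symmetric] using AB(2) by (intro image_cong) (auto simp: f_def)
    have injA: "inj_on f A" using g by (auto simp: bij_betw_def f_def inj_on_def)
    have "inj_on h B" using h by (simp add: bij_betw_def)
    then have injB: "inj_on f B"
      using AB(2) by (subst inj_on_cong[of _ _ h]) (auto simp: f_def)
    have "f x \<noteq> f y" if "x \<in> A" "y \<in> B" for x y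
      using fA fB Qp(2)[OF p] that by blast
    then have inj: "inj_on f (vertices H)"
      unfolding AB(1)[symmetric] inj_on_Un using injA injB by auto
    have im: "f ` vertices H = verts p" using fA fB by (simp add: AB(1)[symmetric] image_Un)
    have "f ` e \<in> edges G" if "e \<in> edges H" for e
    proof -
      from He[OF that] obtain x y where xy: "x \<in> A" "y \<in> B" "e = {x, y}" by blast
      then have "f x \<in> fst p" "f y \<in> snd p" using fA fB by auto
      then have "E (f x) (f y)" "f x \<noteq> f y" "f x \<in> vertices G" "f y \<in> vertices G"
        using Qp[OF p] by (auto simp: biclique_def)
      then show ?thesis using E xy(3) by simp
    qed
    then have "is_copy H G (verts p, (\<lambda>e. f ` e) ` edges H)"
      unfolding is_copy_def using Qp(3)[OF p] inj im by (auto intro!: exI[of _ f])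
    then show ?thesis by (intro exI[of _ "(verts p, (\<lambda>e. f ` e) ` edges H)"]) simp
  qed
  then have "\<forall>p. \<exists>C. p \<in> Q \<longrightarrow> is_copy H G C \<and> vertices C = verts p" by blast
  from choice[OF this] obtain cp where cp: "\<And>p. p \<in> Q \<Longrightarrow> is_copy H G (cp p) \<and> vertices (cp p) = verts p"
    by blast
  have disj: "disjnt (verts p) (verts q)" if "p \<in> Q" "q \<in> Q" "p \<noteq> q" for p q
    using Q that by (auto simp: biclique_packing_def pairwise_def)
  have "inj_on cp Q"
  proof (rule inj_onI, rule ccontr)
    fix p q assume pq: "p \<in> Q" "q \<in> Q" "cp p = cp q" "p \<noteq> q"
    then have "verts p = verts q" using cp by metis
    then have "verts p = {}" using disj[OF pq(1,2,4)] by (simp add: disjnt_def)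
    moreover have "card (fst p) = a" using Qp(1)[OF pq(1)] by (simp add: biclique_def)
    ultimately show False using a by auto
  qed
  then have "card Q = card (cp ` Q)" by (simp add: card_image)
  moreover have "disjoint_copies H G (cp ` Q)"
    unfolding disjoint_copies_def
  proof (intro conjI ballI pairwiseI)
    fix C D assume "C \<in> cp ` Q" "D \<in> cp ` Q" "C \<noteq> D"
    then obtain p q where "p \<in> Q" "q \<in> Q" "p \<noteq> q" "C = cp p" "D = cp q" by blast
    then show "disjnt (vertices C) (vertices D)" using cp disj by metis
  qed (use cp in auto)
  ultimately show ?thesis using packing_number_ge[OF G] by metis
qed

text \<open>The \<open>a\<close> disjoint edges of the image of \<open>M\<close> in a copy each contribute \<open>j\<close> vertices of \<open>U\<close>.\<close>

lemma packing_number_le_hitting_set: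
  fixes H :: "'v ugraph" and G :: "'w ugraph"
  assumes H: "simple_graph H" and M: "matching H M" "card M = a"
    and G: "simple_graph G" and U: "finite U" "\<And>e. e \<in> edges G \<Longrightarrow> j \<le> card (e \<inter> U)"
  shows "j * a * packing_number H G \<le> card U"
proof -
  obtain P where P: "disjoint_copies H G P" "card P = packing_number H G"
    using packing_number_witness[OF G] by blast
  have fG: "finite (vertices G)" "edges G \<subseteq> Pow (vertices G)" using G by (auto simp: simple_graph_def)
  have "P \<subseteq> Pow (vertices G) \<times> Pow (edges G)"
    using P(1) by (fastforce simp: disjoint_copies_def is_copy_def)
  then have fP: "finite P" using fG by (meson finite_Pow_iff finite_SigmaI finite_subset)
  have fM: "finite M"
  proof -
    have "M \<subseteq> Pow (vertices H)" "finite (vertices H)" using M H by (auto simp: matching_def simple_graph_def)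
    then show ?thesis by (meson finite_Pow_iff finite_subset)
  qed
  have each: "a * j \<le> card (vertices C \<inter> U)" if C: "C \<in> P" for C
  proof -
    obtain f where f: "inj_on f (vertices H)" "vertices C = f ` vertices H" "edges C = (\<lambda>e. f ` e) ` edges H"
      and CG: "edges C \<subseteq> edges G"
      using P(1) C by (auto simp: disjoint_copies_def is_copy_def)
    have MH: "e \<in> edges H" "e \<subseteq> vertices H" if "e \<in> M" for e
      using that M H by (auto simp: matching_def simple_graph_def)
    have "a * j = (\<Sum>e\<in>M. j)" by (simp add: M(2))
    also have "\<dots> \<le> (\<Sum>e\<in>M. card (f ` e \<inter> U))"
      using MH(1) CG f(3) by (intro sum_mono U(2)) auto
    also have "\<dots> = card (\<Union>e\<in>M. f ` e \<inter> U)"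
    proof (rule card_UN_disjoint[symmetric])
      show "\<forall>e\<in>M. \<forall>e'\<in>M. e \<noteq> e' \<longrightarrow> (f ` e \<inter> U) \<inter> (f ` e' \<inter> U) = {}"
      proof (intro ballI impI)
        fix e e' assume e: "e \<in> M" "e' \<in> M" "e \<noteq> e'"
        then have "e \<inter> e' = {}" using M by (auto simp: matching_def pairwise_def disjnt_def)
        then have "f ` e \<inter> f ` e' = {}"
          using inj_on_image_Int[OF f(1) MH(2)[OF e(1)] MH(2)[OF e(2)]] by simp
        then show "(f ` e \<inter> U) \<inter> (f ` e' \<inter> U) = {}" by blast
      qed
    qed (use fM U in auto)
    also have "\<dots> \<le> card (vertices C \<inter> U)"
      unfolding f(2) using U(1) MH(2) by (intro card_mono) blast+
    finally show ?thesis .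
  qed
  have "j * a * card P = (\<Sum>C\<in>P. a * j)" by (simp add: mult.commute)
  also have "\<dots> \<le> (\<Sum>C\<in>P. card (vertices C \<inter> U))" using each by (rule sum_mono)
  also have "\<dots> = card (\<Union>C\<in>P. vertices C \<inter> U)"
  proof (rule card_UN_disjoint[symmetric])
    show "\<forall>C\<in>P. \<forall>D\<in>P. C \<noteq> D \<longrightarrow> (vertices C \<inter> U) \<inter> (vertices D \<inter> U) = {}"
    proof (intro ballI impI)
      fix C D assume "C \<in> P" "D \<in> P" "C \<noteq> D"
      then have "vertices C \<inter> vertices D = {}"
        using P(1) unfolding disjoint_copies_def pairwise_def disjnt_def by blast
      then show "(vertices C \<inter> U) \<inter> (vertices D \<inter> U) = {}" by blast
    qed
  qed (use fP U(1) in auto)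
  also have "\<dots> \<le> card U" using U(1) by (intro card_mono) auto
  finally show ?thesis by (simp add: P(2))
qed

section \<open>The two bounds\<close>

text \<open>
The block colouring. The blocks have size \<open>t\<close>, which is \<open>n / (r + 1)\<close> rounded up, so that the last
block has at most \<open>2 * t\<close> vertices; and \<open>t = 0\<close> if \<open>n = 0\<close>.\<close>

lemma Rt_le:
  fixes H :: "'v ugraph"
  assumes r: "r \<ge> 1" and H: "simple_graph H" and M: "matching H M" "card M = a"
  shows "a * Rt r H n \<le> (n + r) div (r + 1)"
proof -
  define t where "t = (n + r) div (r + 1)"
  have "(n + r) mod (r + 1) \<le> r" using mod_less_divisor[of "r + 1" "n + r"] by linarith
  then have t: "n \<le> (r + 1) * t"
    using mult_div_mod_eq[of "r + 1" "n + r"] unfolding t_def by linarith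
  define b where "b v = min r ((v - 1) div t + 1)" for v
  define \<chi> where "\<chi> = restrict (\<lambda>e. Min (b ` e)) (edges (complete_graph n))"
  have b: "b v \<in> {1..r}" for v using r by (auto simp: b_def)
  have edge: "finite e" "e \<noteq> {}" "e \<subseteq> {1..n}" "card e = 2" if "e \<in> edges (complete_graph n)" for e
    using that by (auto simp: complete_graph_def intro: finite_subset)
  have Minb: "Min (b ` e) \<in> b ` e" if "e \<in> edges (complete_graph n)" for e
    using edge[OF that] by (intro Min_in) auto
  then have "Min (b ` e) \<in> {1..r}" if "e \<in> edges (complete_graph n)" for e
    using b that by (metis imageE)
  then have "\<chi> \<in> colourings r n"
    unfolding colourings_def \<chi>_def by (intro restrict_PiE_iff[THEN iffD2] ballI)
  have "packing_number H (colour_class n \<chi> l) * a \<le> t" if l: "l \<in> {1..r}" for l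
  proof -
    define U where "U = {v\<in>{1..n}. b v = l}"
    have fU: "finite U" by (simp add: U_def)
    have sg: "simple_graph (colour_class n \<chi> l)" by (rule simple_graph_colour_class)
    have ce: "e \<in> edges (complete_graph n)" "Min (b ` e) = l" if "e \<in> edges (colour_class n \<chi> l)" for e
      using that by (auto simp: colour_class_def \<chi>_def)
    show ?thesis
    proof (cases "l < r")
      case True
      have "1 \<le> card (e \<inter> U)" if "e \<in> edges (colour_class n \<chi> l)" for e
      proof -
        have "l \<in> b ` e" using Minb[OF ce(1)[OF that]] ce(2)[OF that] by simp
        then obtain v where "v \<in> e" "b v = l" by blast
        then have "v \<in> e \<inter> U" using edge(3)[OF ce(1)[OF that]] by (auto simp: U_def)
        then have "e \<inter> U \<noteq> {}" by blast
        then show ?thesis using fU by (simp add: Suc_le_eq card_gt_0_iff)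
      qed
      from packing_number_le_hitting_set[OF H M sg fU this]
      have "a * packing_number H (colour_class n \<chi> l) \<le> card U" by simp
      also have "U \<subseteq> {(l - 1) * t + 1..l * t}"
      proof
        fix v assume v: "v \<in> U"
        then have bv: "(v - 1) div t + 1 = l" "1 \<le> v" "v \<le> n" using True by (auto simp: U_def b_def min_def split: if_splits)
        then have "t > 0" using t by (cases "t = 0") auto
        have dm: "(v - 1) = t * (l - 1) + (v - 1) mod t" 
        proof -
          have "(v - 1) div t = l - 1" using bv(1) by simp
          then show ?thesis using mult_div_mod_eq[of t "v - 1"] by simp
        qed
        have "(v - 1) mod t < t" using \<open>t > 0\<close> by simp
        moreover have "t * l = t * (l - 1) + t" using l by (cases l) auto
        ultimately show "v \<in> {(l - 1) * t + 1..l * t}"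
          using dm bv(2) by (auto simp: mult.commute)
      qed
      then have "card U \<le> card {(l - 1) * t + 1..l * t}" by (intro card_mono) auto
      also have "\<dots> = t" using l by (cases l) auto
      finally show ?thesis by (simp add: mult.commute)
    next
      case False
      then have lr: "l = r" using l by simp
      have "2 \<le> card (e \<inter> U)" if "e \<in> edges (colour_class n \<chi> l)" for e
      proof -
        have "b v = l" if "v \<in> e" for v
        proof -
          have "l \<le> b v" using ce(2)[OF \<open>e \<in> edges (colour_class n \<chi> l)\<close>] that
              edge(1)[OF ce(1)[OF \<open>e \<in> edges (colour_class n \<chi> l)\<close>]] by (metis Min_le finite_imageI imageI)
          then show ?thesis using b[of v] lr by simp
        qed
        then have "e \<inter> U = e" using edge(3)[OF ce(1)[OF that]] by (auto simp: U_def)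
        then show ?thesis using edge(4)[OF ce(1)[OF that]] by simp
      qed
      from packing_number_le_hitting_set[OF H M sg fU this]
      have "2 * a * packing_number H (colour_class n \<chi> l) \<le> card U" .
      also have "U \<subseteq> {(r - 1) * t + 1..(r + 1) * t}"
      proof
        fix v assume v: "v \<in> U"
        then have bv: "r \<le> (v - 1) div t + 1" "1 \<le> v" "v \<le> n"
          using lr by (auto simp: U_def b_def min_def split: if_splits)
        have "(r - 1) * t \<le> (v - 1) div t * t" using bv(1) by (intro mult_le_mono1) simp
        also have "\<dots> \<le> v - 1" by simp
        finally show "v \<in> {(r - 1) * t + 1..(r + 1) * t}" using bv t by simp
      qed
      then have "card U \<le> card {(r - 1) * t + 1..(r + 1) * t}" by (intro card_mono) auto
      also have "\<dots> = 2 * t" using r by (cases r) auto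
      finally show ?thesis by (simp add: mult.commute)
    qed
  qed
  note all = this
  have "nu r n H \<chi> * a \<le> t"
  proof -
    have "nu r n H \<chi> \<in> (\<lambda>l. packing_number H (colour_class n \<chi> l)) ` {1..r}"
      unfolding nu_def using r by (intro Max_in) auto
    then show ?thesis using all by auto
  qed
  moreover have "Rt r H n \<le> nu r n H \<chi>"
    unfolding Rt_def using \<open>\<chi> \<in> colourings r n\<close> finite_colourings by (intro Min_le) auto
  ultimately show ?thesis
    unfolding t_def by (metis le_trans mult.commute mult_le_mono1)
qed

lemma Rt_ge:
  fixes H :: "'v ugraph"
  assumes r: "r \<ge> 1" and a: "a \<ge> 1" and s: "s \<ge> 1"
    and bip: "bipartition H A B" "card A = a" "card B = a"
  shows "\<exists>n0. \<forall>n\<ge>n0. 2 * s * n \<le> (r + 1) * (2 * s * a * Rt r H n + 6 * n) + 2 * n"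
proof -
  obtain n0 where n0: "\<And>(V :: nat set) c k. finite V \<Longrightarrow> n0 \<le> card V \<Longrightarrow>
      (\<forall>u\<in>V. \<forall>v\<in>V. u \<noteq> v \<longrightarrow> c u v \<in> {1..r}) \<Longrightarrow>
      (\<forall>l\<in>{1..r}. \<forall>Q. biclique_packing (\<lambda>u v. c u v = l) a V Q \<longrightarrow> card Q \<le> k) \<Longrightarrow>
      2 * s * card V \<le> (r + 1) * (2 * s * a * k + 6 * card V) + 2 * card V"
    using monochromatic_packing_bound[OF a r s, where 'v = nat] by blast
  have "2 * s * n \<le> (r + 1) * (2 * s * a * Rt r H n + 6 * n) + 2 * n" if n: "n0 \<le> n" for n
  proof -
    have "Rt r H n \<in> nu r n H ` colourings r n"
      unfolding Rt_def using finite_colourings colourings_nonempty[OF r] by (intro Min_in) auto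
    then obtain \<chi> where \<chi>: "\<chi> \<in> colourings r n" "Rt r H n = nu r n H \<chi>" by blast
    have c: "\<chi> {u, v} \<in> {1..r}" if "u \<in> {1..n}" "v \<in> {1..n}" "u \<noteq> v" for u v
      using \<chi>(1) that unfolding colourings_def complete_graph_def by (auto simp: PiE_def Pi_def)
    have k: "card Q \<le> nu r n H \<chi>"
      if l: "l \<in> {1..r}" and Q: "biclique_packing (\<lambda>u v. \<chi> {u, v} = l) a {1..n} Q" for l Q
    proof -
      have "card Q \<le> packing_number H (colour_class n \<chi> l)"
        using Q by (intro biclique_packing_le_packing_number[OF a bip simple_graph_colour_class,
              of n \<chi> l "\<lambda>u v. \<chi> {u, v} = l"])
          (auto simp: colour_class_def complete_graph_def)
      also have "\<dots> \<le> nu r n H \<chi>" unfolding nu_def using l by (intro Max_ge) auto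
      finally show ?thesis .
    qed
    show ?thesis
      using n0[of "{1..n}" "\<lambda>u v. \<chi> {u, v}" "nu r n H \<chi>"] n c k by (simp add: \<chi>(2))
  qed
  then show ?thesis by blast
qed

theorem theorem6p13:
  fixes r a :: nat and H :: "'v ugraph" and A B :: "'v set" and M :: "'v set set"
  assumes "r \<ge> 1" and "a \<ge> 1"
    and "simple_graph H" and "connected_graph H"
    and "bipartition H A B" and "card A = a" and "card B = a"
    and "matching H M" and "card M = a"
  shows "\<exists>\<epsilon> :: nat \<Rightarrow> real. \<epsilon> \<in> o(\<lambda>n. 1) \<and>
           (\<forall>n. real (Rt r H n) = (1 / (real a * (real r + 1)) + \<epsilon> n) * real n)"
proof -
  define d where "d = real a * (real r + 1)"
  define \<epsilon> where "\<epsilon> n = real (Rt r H n) / real n - 1 / d" for n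
  have d: "d > 0" using assms(2) by (simp add: d_def)
  have upper: "a * Rt r H n \<le> (n + r) div (r + 1)" for n
    using Rt_le[OF assms(1,3,8,9)] .
  have "real (Rt r H n) = (1 / d + \<epsilon> n) * real n" for n
  proof (cases "n = 0")
    case True
    then have "a * Rt r H n = 0" using upper[of n] by simp
    then show ?thesis using True assms(2) by simp
  qed (simp add: \<epsilon>_def)
  moreover have "\<epsilon> \<longlonglongrightarrow> 0"
  proof (rule LIMSEQ_I)
    fix \<delta> :: real assume \<delta>: "\<delta> > 0"
    obtain s :: nat where s: "4 / \<delta> < real s" using reals_Archimedean2 by blast
    moreover have "0 < 4 / \<delta>" using \<delta> by simp
    ultimately have "0 < real s" by linarith
    then have s1: "s \<ge> 1" by simp
    obtain n0 where n0: "\<And>n. n \<ge> n0 \<Longrightarrow> 2 * s * n \<le> (r + 1) * (2 * s * a * Rt r H n + 6 * n) + 2 * n"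
      using Rt_ge[OF assms(1,2) s1 assms(5,6,7)] by blast
    obtain n1 :: nat where n1: "real r / (d * \<delta>) < real n1" using reals_Archimedean2 by blast
    have "norm (\<epsilon> n - 0) < \<delta>" if n: "n \<ge> max n0 (max n1 1)" for n
    proof -
      have npos: "real n > 0" using n by simp
      have "real (2 * s * n) \<le> real ((r + 1) * (2 * s * a * Rt r H n + 6 * n) + 2 * n)"
        using n0[of n] n by (simp only: of_nat_le_iff)
      then have "2 * real s * real n \<le> 2 * real s * d * real (Rt r H n) + (6 * (real r + 1) + 2) * real n"
        by (simp add: d_def algebra_simps)
      also have "\<dots> \<le> 2 * real s * d * real (Rt r H n) + 8 * d * real n"
      proof -
        have "1 * (real r + 1) \<le> d" unfolding d_def using assms(2) by (intro mult_right_mono) auto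
        then have "6 * (real r + 1) + 2 \<le> 8 * d" by simp
        then show ?thesis using npos by (simp add: mult_right_mono)
      qed
      finally have "real n / d - 4 * real n / real s \<le> real (Rt r H n)"
        using d s1 by (simp add: field_simps)
      then have "(real n / d - 4 * real n / real s) / real n \<le> real (Rt r H n) / real n"
        using npos by (intro divide_right_mono) auto
      then have "- (4 / real s) \<le> \<epsilon> n" using npos by (simp add: \<epsilon>_def diff_divide_distrib)
      moreover have "4 / real s < \<delta>" using s \<delta> s1 by (simp add: field_simps)
      ultimately have lo: "- \<delta> < \<epsilon> n" by linarith
      have "(r + 1) * (a * Rt r H n) \<le> (r + 1) * ((n + r) div (r + 1))"
        using upper[of n] by (rule mult_le_mono2)
      also have "\<dots> \<le> n + r" by (metis mult.commute div_times_less_eq_dividend)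
      finally have "real ((r + 1) * (a * Rt r H n)) \<le> real (n + r)" by (simp only: of_nat_le_iff)
      then have "d * real (Rt r H n) \<le> real n + real r" by (simp add: d_def algebra_simps)
      then have "real (Rt r H n) \<le> (real n + real r) / d"
        using d by (simp add: pos_le_divide_eq mult.commute)
      then have "real (Rt r H n) / real n \<le> (real n + real r) / d / real n"
        using npos by (intro divide_right_mono) auto
      also have "\<dots> = 1 / d + real r / (d * real n)" using npos d by (simp add: field_simps)
      finally have "real (Rt r H n) / real n - 1 / d \<le> real r / (d * real n)" by simp
      also have "\<dots> < \<delta>"
      proof -
        have "real r / (d * \<delta>) < real n" using n1 n by simp
        then show ?thesis using d npos \<delta> by (simp add: field_simps)
      qed
      finally have "\<epsilon> n < \<delta>" by (simp add: \<epsilon>_def)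
      then show ?thesis using lo by simp
    qed
    then show "\<exists>no. \<forall>n\<ge>no. norm (\<epsilon> n - 0) < \<delta>" by blast
  qed
  then have "\<epsilon> \<in> o(\<lambda>n. 1)" by (intro smalloI_tendsto) auto
  ultimately show ?thesis unfolding d_def by blast
qed

end
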